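(* Let $m\le n$ be positive integers and $q\in\mathbb C$ not a root of unity. Let $\gamma\in\Pi_{m,n}$. Then the two-sided ideal of $\mathcal O_q(G_{m,n}(\mathbb C))$ generated by $\{[\pi]:\pi\in\Pi_{m,n},\ \pi\not\ge_{\rm st}\gamma\}$ is generated by this same set as a right ideal.
   Context: $\mathcal O_q(M_{m,n}(\mathbb C))$ is the $\mathbb C$-algebra generated by $X_{ij}$ ($1\le i\le m$, $1\le j\le n$) subject to: $X_{ij}X_{il}=qX_{il}X_{ij}$ for $j<l$; $X_{ij}X_{kj}=qX_{kj}X_{ij}$ for $i<k$; $X_{ij}X_{kl}=X_{kl}X_{ij}$ for $k<i$, $j<l$; $X_{ij}X_{kl}-X_{kl}X_{ij}=(q-q^{-1})X_{il}X_{kj}$ for $i<k$, $j<l$. $\Pi_{m,n}$ is the set of $m$-subsets $\{j_1<\dots<j_m\}$ of $\{1,\dots,n\}$ ordered by $\{i_1<\dots<i_m\}\le_{\rm st}\{j_1<\dots<j_m\}$ iff $i_s\le j_s$ for all $s$; $[J]=\sum_{\sigma\in\mathfrak S_m}(-q)^{\ell(\sigma)}X_{1j_{\sigma(1)}}\cdots X_{mj_{\sigma(m)}}$. $\mathcal O_q(G_{m,n}(\mathbb C))$ is the subalgebra generated by all $[J]$. *)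

theory Defs
  imports Complex_Main "HOL-Library.Poly_Mapping" "HOL-Combinatorics.Permutations"
begin

text \<open>Noncommutative polynomials: finitely supported functions from words
(lists of generator indices) to complex coefficients.\<close>

type_synonym ncpoly = "(nat \<times> nat) list \<Rightarrow>\<^sub>0 complex"

definition ncmul :: "ncpoly \<Rightarrow> ncpoly \<Rightarrow> ncpoly" where
  "ncmul p r = (\<Sum>u\<in>Poly_Mapping.keys p. \<Sum>v\<in>Poly_Mapping.keys r.
       Poly_Mapping.single (u @ v) (Poly_Mapping.lookup p u * Poly_Mapping.lookup r v))"

definition ncconst :: "complex \<Rightarrow> ncpoly" where
  "ncconst c = Poly_Mapping.single [] c"

definition ncX :: "nat \<Rightarrow> nat \<Rightarrow> ncpoly" where
  "ncX i j = Poly_Mapping.single [(i, j)] 1"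

definition qmat_rels :: "nat \<Rightarrow> nat \<Rightarrow> complex \<Rightarrow> ncpoly set" where
  "qmat_rels m n q =
     {ncmul (ncX i j) (ncX i l) - ncmul (ncconst q) (ncmul (ncX i l) (ncX i j)) | i j l.
        1 \<le> i \<and> i \<le> m \<and> 1 \<le> j \<and> j < l \<and> l \<le> n}
   \<union> {ncmul (ncX i j) (ncX k j) - ncmul (ncconst q) (ncmul (ncX k j) (ncX i j)) | i j k.
        1 \<le> i \<and> i < k \<and> k \<le> m \<and> 1 \<le> j \<and> j \<le> n}
   \<union> {ncmul (ncX i j) (ncX k l) - ncmul (ncX k l) (ncX i j) | i j k l.
        1 \<le> k \<and> k < i \<and> i \<le> m \<and> 1 \<le> j \<and> j < l \<and> l \<le> n}
   \<union> {ncmul (ncX i j) (ncX k l) - ncmul (ncX k l) (ncX i j)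
        - ncmul (ncconst (q - inverse q)) (ncmul (ncX i l) (ncX k j)) | i j k l.
        1 \<le> i \<and> i < k \<and> k \<le> m \<and> 1 \<le> j \<and> j < l \<and> l \<le> n}"

text \<open>Two-sided ideal of the free algebra generated by the relations;
O_q(M_{m,n}) is the free algebra modulo this ideal.\<close>

inductive_set qmat_ideal :: "nat \<Rightarrow> nat \<Rightarrow> complex \<Rightarrow> ncpoly set"
  for m n q where
  rel: "r \<in> qmat_rels m n q \<Longrightarrow> r \<in> qmat_ideal m n q"
| zero: "0 \<in> qmat_ideal m n q"
| add: "x \<in> qmat_ideal m n q \<Longrightarrow> y \<in> qmat_ideal m n q \<Longrightarrow> x + y \<in> qmat_ideal m n q"
| lmul: "x \<in> qmat_ideal m n q \<Longrightarrow> ncmul a x \<in> qmat_ideal m n q"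
| rmul: "x \<in> qmat_ideal m n q \<Longrightarrow> ncmul x a \<in> qmat_ideal m n q"

definition qmat_cong :: "nat \<Rightarrow> nat \<Rightarrow> complex \<Rightarrow> ncpoly \<Rightarrow> ncpoly \<Rightarrow> bool" where
  "qmat_cong m n q x y \<longleftrightarrow> x - y \<in> qmat_ideal m n q"

definition Pi_mn :: "nat \<Rightarrow> nat \<Rightarrow> nat set set" where
  "Pi_mn m n = {J. J \<subseteq> {1..n} \<and> card J = m}"

definition jth :: "nat set \<Rightarrow> nat \<Rightarrow> nat" where
  "jth J s = sorted_list_of_set J ! (s - 1)"

definition st_le :: "nat \<Rightarrow> nat set \<Rightarrow> nat set \<Rightarrow> bool" where
  "st_le m I J \<longleftrightarrow> (\<forall>s\<in>{1..m}. jth I s \<le> jth J s)"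

definition perm_length :: "nat \<Rightarrow> (nat \<Rightarrow> nat) \<Rightarrow> nat" where
  "perm_length m \<sigma> = card {(a, b). a \<in> {1..m} \<and> b \<in> {1..m} \<and> a < b \<and> \<sigma> b < \<sigma> a}"

definition qminor :: "nat \<Rightarrow> complex \<Rightarrow> nat set \<Rightarrow> ncpoly" where
  "qminor m q J = (\<Sum>\<sigma>\<in>{\<sigma>. \<sigma> permutes {1..m}}.
      Poly_Mapping.single (map (\<lambda>s. (s, jth J (\<sigma> s))) [1..<m+1]) ((- q) ^ perm_length m \<sigma>))"

section \<open>The subalgebra O_q(G_{m,n}) (lifted to the free algebra)\<close>

inductive_set gen_subalg :: "ncpoly set \<Rightarrow> ncpoly set" for Gen where
  gen: "g \<in> Gen \<Longrightarrow> g \<in> gen_subalg Gen"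
| const: "ncconst c \<in> gen_subalg Gen"
| add: "x \<in> gen_subalg Gen \<Longrightarrow> y \<in> gen_subalg Gen \<Longrightarrow> x + y \<in> gen_subalg Gen"
| mul: "x \<in> gen_subalg Gen \<Longrightarrow> y \<in> gen_subalg Gen \<Longrightarrow> ncmul x y \<in> gen_subalg Gen"

definition qgrass_lift :: "nat \<Rightarrow> nat \<Rightarrow> complex \<Rightarrow> ncpoly set" where
  "qgrass_lift m n q = gen_subalg (qminor m q ` Pi_mn m n)"

inductive_set twosided_gen :: "ncpoly set \<Rightarrow> ncpoly set \<Rightarrow> ncpoly set" for A S where
  zero: "0 \<in> twosided_gen A S"
| gen: "s \<in> S \<Longrightarrow> a \<in> A \<Longrightarrow> b \<in> A \<Longrightarrow> ncmul (ncmul a s) b \<in> twosided_gen A S"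
| add: "x \<in> twosided_gen A S \<Longrightarrow> y \<in> twosided_gen A S \<Longrightarrow> x + y \<in> twosided_gen A S"

inductive_set right_gen :: "ncpoly set \<Rightarrow> ncpoly set \<Rightarrow> ncpoly set" for A S where
  zero: "0 \<in> right_gen A S"
| gen: "s \<in> S \<Longrightarrow> b \<in> A \<Longrightarrow> ncmul s b \<in> right_gen A S"
| add: "x \<in> right_gen A S \<Longrightarrow> y \<in> right_gen A S \<Longrightarrow> x + y \<in> right_gen A S"

end

theory Submission
  imports Defs "HOL-Combinatorics.Multiset_Permutations"
begin

text \<open>
  The right ideal generated by the given minors absorbs left multiplication as soon as every product
  \<open>[J][K]\<close> is a combination of products \<open>[K'][J']\<close> with \<open>K' \<le> K\<close> in the order of
  \<open>\<Pi>\<close>, because the index set of the generators is closed downwards.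

  To obtain such a commutation relation, let \<open>e\<^sub>1, \<dots>, e\<^sub>n\<close> and \<open>f\<^sub>1, \<dots>, f\<^sub>n\<close> be operators on a Fock
  space with \<open>e\<^sub>j\<^sup>2 = 0\<close> and \<open>e\<^sub>l e\<^sub>j = - q e\<^sub>j e\<^sub>l\<close> for \<open>j < l\<close>, likewise for \<open>f\<close>, and with the
  R-matrix cross relations \<open>f\<^sub>j e\<^sub>j = q e\<^sub>j f\<^sub>j\<close>, \<open>f\<^sub>l e\<^sub>j = e\<^sub>j f\<^sub>l\<close> and
  \<open>f\<^sub>j e\<^sub>l = e\<^sub>l f\<^sub>j + (q - 1/q) e\<^sub>j f\<^sub>l\<close> for \<open>j < l\<close>. Put \<open>\<omega>\<^sub>i = \<Sum> X\<^sub>i\<^sub>j e\<^sub>j\<close> and \<open>\<eta>\<^sub>i = \<Sum> X\<^sub>i\<^sub>j f\<^sub>j\<close>.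
  Then \<open>\<Omega> = \<omega>\<^sub>1 \<dots> \<omega>\<^sub>m = \<Sum> [J] e\<^sub>J\<close> and \<open>H = \<eta>\<^sub>1 \<dots> \<eta>\<^sub>m = \<Sum> [K] f\<^sub>K\<close>, and the defining relations
  of the \<open>X\<^sub>i\<^sub>j\<close> give \<open>H \<Omega> = q\<^sup>m \<Omega> H\<close>. On the vacuum, \<open>e\<^sub>J f\<^sub>K\<close> yields a unit multiple of the
  basis vector \<open>|J,K\<rangle>\<close>, whereas \<open>f\<^sub>K' e\<^sub>J'\<close> reaches \<open>|J,K\<rangle>\<close> only if \<open>K' \<le> K\<close>, since \<open>f\<^sub>j\<close> adds to
  the second index set either \<open>j\<close> or something larger. Comparing coefficients at \<open>|J,K\<rangle>\<close> gives the relation.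
\<close>

section \<open>Fock space operators\<close>

datatype site = S0 | SE | SF | SEF

text \<open>Fock vectors will have matrix entries as coefficients, so scalars and entries live in
  one noncommutative ring; hence \<open>q\<close> is a central unit of that ring rather than an
  element of a ground field.\<close>

locale quantum_scalars =
  fixes q qi :: "'a::ring_1"
  assumes q_qi: "q * qi = 1" and qi_q: "qi * q = 1"
    and q_central: "\<And>x. x * q = q * x" and qi_central: "\<And>x. x * qi = qi * x"
begin

lemma q_cancel [simp]: "q * (qi * x) = x" "qi * (q * x) = x" "q * qi = 1" "qi * q = 1"
  by (simp_all add: q_qi qi_q flip: mult.assoc)

text \<open>
  The basis of the Fock space consists of lists of \<open>n\<close> sites, the head being column \<open>n\<close>; a site records
  whether \<open>e\<close> and \<open>f\<close> are occupied there. A vector is its coefficient function and operators act by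
  pullback. Adding a last column replaces \<open>e\<^sub>j\<close> by \<open>e\<^sub>j \<otimes> k\<^sub>E\<close> and \<open>f\<^sub>j\<close> by
  \<open>f\<^sub>j \<otimes> k\<^sub>F + e\<^sub>j \<otimes> E\<close>, where \<open>E\<close> turns an \<open>e\<close> into \<open>(q - 1/q)\<close> times an \<open>f\<close>.
\<close>

fun kE :: "site \<Rightarrow> 'a" where
  "kE S0 = 1" | "kE SE = - qi" | "kE SF = 1" | "kE SEF = - qi"

fun kF :: "site \<Rightarrow> 'a" where
  "kF S0 = 1" | "kF SE = 1" | "kF SF = - qi" | "kF SEF = - qi"

fun opE :: "nat \<Rightarrow> nat \<Rightarrow> (site list \<Rightarrow> 'a) \<Rightarrow> site list \<Rightarrow> 'a" where
  "opE (Suc n) j v (x # xs) =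
     (if j = Suc n then (case x of SE \<Rightarrow> v (S0 # xs) | SEF \<Rightarrow> v (SF # xs) | _ \<Rightarrow> 0)
      else kE x * opE n j (\<lambda>ys. v (x # ys)) xs)"
| "opE _ j v _ = 0"

fun opF :: "nat \<Rightarrow> nat \<Rightarrow> (site list \<Rightarrow> 'a) \<Rightarrow> site list \<Rightarrow> 'a" where
  "opF (Suc n) j v (x # xs) =
     (if j = Suc n then (case x of SF \<Rightarrow> v (S0 # xs) | SEF \<Rightarrow> q * v (SE # xs) | _ \<Rightarrow> 0)
      else kF x * opF n j (\<lambda>ys. v (x # ys)) xs
         + (if x = SF then (q - qi) * opE n j (\<lambda>ys. v (SE # ys)) xs else 0))"
| "opF _ j v _ = 0"

section \<open>Linearity of the Fock operators\<close>

lemma opE_Nil [simp]: "opE n j v [] = 0" and opF_Nil [simp]: "opF n j v [] = 0"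
  by (cases n; simp)+

lemma opE_zero [simp]: "opE n j (\<lambda>s. 0) s = 0"
proof (induction n arbitrary: s)
  case (Suc n) then show ?case by (cases s) (auto split: site.split)
qed simp

lemma opF_zero [simp]: "opF n j (\<lambda>s. 0) s = 0"
proof (induction n arbitrary: s)
  case (Suc n) then show ?case by (cases s) (auto split: site.split)
qed simp

lemma opE_add: "opE n j (\<lambda>s. v s + w s) s = opE n j v s + opE n j w s"
proof (induction n arbitrary: v w s)
  case (Suc n) then show ?case by (cases s) (auto split: site.split simp: algebra_simps)
qed simp

lemma opF_add: "opF n j (\<lambda>s. v s + w s) s = opF n j v s + opF n j w s"
proof (induction n arbitrary: v w s)
  case (Suc n) then show ?case by (cases s) (auto split: site.split simp: algebra_simps opE_add)
qed simp

lemma kE_central: "c * (kE x * y) = kE x * (c * y)"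
  by (cases x) (simp_all add: qi_central flip: mult.assoc)

lemma kF_central: "c * (kF x * y) = kF x * (c * y)"
  by (cases x) (simp_all add: qi_central flip: mult.assoc)

lemma q_left_commute: "c * (q * y) = q * (c * y)" "c * (qi * y) = qi * (c * y)"
  by (simp_all add: qi_central q_central flip: mult.assoc)

text \<open>Here \<open>c\<close> is any ring element: the operator's own coefficients are products
  of \<open>1\<close> and \<open>- qi\<close>, which are central. This lets matrix entries be pulled
  out of the operators.\<close>

lemma opE_scale: "opE n j (\<lambda>s. c * v s) s = c * opE n j v s"
proof (induction n arbitrary: v s)
  case (Suc n) then show ?case by (cases s) (auto split: site.split simp: kE_central)
qed simp

lemma opF_scale: "opF n j (\<lambda>s. c * v s) s = c * opF n j v s"
proof (induction n arbitrary: v s)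
  case (Suc n)
  have "c * ((q - qi) * y) = (q - qi) * (c * y)" for y
    by (simp add: left_diff_distrib right_diff_distrib q_left_commute)
  moreover have "q * (c * y) = c * (q * y)" for y by (simp add: q_left_commute)
  ultimately show ?case using Suc
    by (cases s) (auto split: site.split simp: kF_central opE_scale distrib_left)
qed simp

lemma opE_sum: "opE n j (\<lambda>s. \<Sum>i\<in>I. v i s) s = (\<Sum>i\<in>I. opE n j (v i) s)"
  by (induction I rule: infinite_finite_induct) (simp_all add: opE_add)

lemma opF_sum: "opF n j (\<lambda>s. \<Sum>i\<in>I. v i s) s = (\<Sum>i\<in>I. opF n j (v i) s)"
  by (induction I rule: infinite_finite_induct) (simp_all add: opF_add)

lemma opE_minus: "opE n j (\<lambda>s. - v s) s = - opE n j v s"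
  using opE_scale[of n j "-1" v s] by simp

lemma opE_diff: "opE n j (\<lambda>s. v s - w s) s = opE n j v s - opE n j w s"
  using opE_add[of n j v "\<lambda>s. - w s"] by (simp add: opE_minus)

lemma opF_minus: "opF n j (\<lambda>s. - v s) s = - opF n j v s"
  using opF_scale[of n j "-1" v s] by simp

lemma opF_diff: "opF n j (\<lambda>s. v s - w s) s = opF n j v s - opF n j w s"
  using opF_add[of n j v "\<lambda>s. - w s"] by (simp add: opF_minus)

lemma opE_large: "n < j \<Longrightarrow> opE n j v s = 0"
proof (induction n arbitrary: v s)
  case (Suc n) then show ?case by (cases s) auto
qed simp

lemma opF_large: "n < j \<Longrightarrow> opF n j v s = 0"
proof (induction n arbitrary: v s)
  case (Suc n) then show ?case by (cases s) (auto simp: opE_large)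
qed simp

lemmas opE_linear = opE_scale opE_add opE_minus opE_diff
lemmas opF_linear = opF_scale opF_add opF_minus opF_diff

section \<open>Exterior and cross relations of the Fock operators\<close>

lemma opE_opE_same: "opE n j (opE n j v) s = 0"
proof (induction n arbitrary: v s)
  case (Suc n) then show ?case
    by (cases s) (auto split: site.split simp: opE_linear)
qed simp

text \<open>When \<open>l\<close> is the last column, \<open>e_l\<close> changes the last site from
  one with \<open>kE\<close> equal to \<open>1\<close> to one with \<open>kE\<close> equal to
  \<open>- qi\<close>, and this produces the factor \<open>- q\<close>. Smaller \<open>l\<close>
  reduce to fewer columns.\<close>

lemma opE_opE: "j < l \<Longrightarrow> opE n l (opE n j v) s = - (q * opE n j (opE n l v) s)"
proof (induction n arbitrary: v s)
  case (Suc n)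
  note IH = Suc.IH[OF Suc.prems]
  show ?case
  proof (cases s)
    case (Cons x xs)
    consider "l = Suc n" | "l < Suc n" | "l > Suc n" by linarith
    then show ?thesis
    proof cases
      case 1
      then show ?thesis using Cons Suc.prems
        by (cases x) (auto simp: opE_linear)
    next
      case 2
      then show ?thesis using Cons Suc.prems IH
        by (cases x) (auto simp: opE_linear)
    next
      case 3
      then show ?thesis using Cons Suc.prems by (simp add: opE_large)
    qed
  qed simp
qed simp

lemma opF_opE_same: "opF n j (opE n j v) s = q * opE n j (opF n j v) s"
proof (induction n arbitrary: v s)
  case (Suc n) then show ?case
    by (cases s; cases "hd s") (auto split: site.split simp: opE_linear opF_linear opE_opE_same)
qed simp

text \<open>For \<open>l\<close> below the last column the only new case is a last site
  \<open>SF\<close> reached from \<open>SE\<close>, where the factor \<open>- qi\<close> of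
  \<open>kE SE\<close> cancels the \<open>- q\<close> of \<open>opE_opE\<close>.\<close>

lemma opF_opE_less: "j < l \<Longrightarrow> opF n l (opE n j v) s = opE n j (opF n l v) s"
proof (induction n arbitrary: v s)
  case (Suc n)
  note IH = Suc.IH[OF Suc.prems]
  show ?case
  proof (cases s)
    case (Cons x xs)
    consider "l = Suc n" | "l < Suc n" | "l > Suc n" by linarith
    then show ?thesis
    proof cases
      case 1
      then show ?thesis using Cons Suc.prems
        by (cases x) (auto simp: opE_linear)
    next
      case 2
      then show ?thesis using Cons Suc.prems IH
        by (cases x) (auto simp: opE_linear opF_linear opE_opE algebra_simps)
    next
      case 3
      then show ?thesis using Cons Suc.prems by (simp add: opF_large opE_large)
    qed
  qed simp
qed simp

text \<open>For the last column \<open>l\<close> the correction term comes from the summand of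
  \<open>opF\<close> that turns an \<open>e\<close> into an \<open>f\<close>. For smaller
  \<open>l\<close> that summand is accounted for by \<open>- q + (q - qi) = - qi\<close>.\<close>

lemma opF_opE_greater:
  "j < l \<Longrightarrow> opF n j (opE n l v) s = opE n l (opF n j v) s + (q - qi) * opE n j (opF n l v) s"
proof (induction n arbitrary: v s)
  case (Suc n)
  note IH = Suc.IH[OF Suc.prems]
  show ?case
  proof (cases s)
    case (Cons x xs)
    consider "l = Suc n" | "l < Suc n" | "l > Suc n" by linarith
    then show ?thesis
    proof cases
      case 1
      then show ?thesis using Cons Suc.prems
        by (cases x) (auto simp: opE_linear opF_linear algebra_simps)
    next
      case 2
      then show ?thesis using Cons Suc.prems
        by (cases x) (auto simp: IH opE_linear opF_linear opE_opE algebra_simps)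
    next
      case 3
      then show ?thesis using Cons Suc.prems by (simp add: opF_large opE_large)
    qed
  qed simp
qed simp

text \<open>The summand of \<open>opF\<close> containing \<open>opE\<close> produces mixed products,
  so relations among the \<open>f\<close> rest on the cross relations; here
  \<open>opF_opE_same\<close> makes the two mixed terms cancel.\<close>

lemma opF_opF_same: "opF n j (opF n j v) s = 0"
proof (induction n arbitrary: v s)
  case (Suc n) then show ?case
    by (cases s; cases "hd s")
       (auto split: site.split simp: opE_linear opF_linear opE_opE_same opF_opE_same algebra_simps)
qed simp

lemma opF_opF: "j < l \<Longrightarrow> opF n l (opF n j v) s = - (q * opF n j (opF n l v) s)"
proof (induction n arbitrary: v s)
  case (Suc n)
  note IH = Suc.IH[OF Suc.prems]
  show ?case
  proof (cases s)
    case (Cons x xs)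
    consider "l = Suc n" | "l < Suc n" | "l > Suc n" by linarith
    then show ?thesis
    proof cases
      case 1
      then show ?thesis using Cons Suc.prems
        by (cases x) (auto simp: opE_linear opF_linear algebra_simps)
    next
      case 2
      then show ?thesis using Cons Suc.prems
        by (cases x) (auto simp: IH opE_linear opF_linear opE_opE opF_opE_less opF_opE_greater algebra_simps)
    next
      case 3
      then show ?thesis using Cons Suc.prems by (simp add: opF_large opE_large)
    qed
  qed simp
qed simp

end

lemma finite_Pi_mn: "finite (Pi_mn m n)"
  unfolding Pi_mn_def by (rule finite_subset[of _ "Pow {1..n}"]) auto

lemma finite_of_Pi_mn: "J \<in> Pi_mn m n \<Longrightarrow> finite J"
  using finite_subset[of J "{1..n}"] by (auto simp: Pi_mn_def)

section \<open>Minors as coefficients of products of row operators\<close>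

fun inversions :: "nat list \<Rightarrow> nat" where
  "inversions [] = 0"
| "inversions (x # xs) = card {y \<in> set xs. y < x} + inversions xs"

text \<open>Off-diagonal terms are grouped as unordered pairs because each exchange relation below
  involves the columns \<open>j\<close> and \<open>l\<close> in both orders.\<close>

lemma double_sum_triangle:
  fixes g :: "nat \<Rightarrow> nat \<Rightarrow> 'b::comm_monoid_add"
  shows "(\<Sum>j=1..n. \<Sum>l=1..n. g j l)
       = (\<Sum>j=1..n. g j j) + (\<Sum>l=1..n. \<Sum>j=1..<l. g j l + g l j)"
proof (induction n)
  case (Suc n)
  have "(\<Sum>j=1..Suc n. \<Sum>l=1..Suc n. g j l)
      = (\<Sum>j=1..n. \<Sum>l=1..n. g j l) + (\<Sum>j=1..n. g j (Suc n)) + (\<Sum>l=1..n. g (Suc n) l)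
        + g (Suc n) (Suc n)"
    by (simp add: sum.distrib add_ac)
  moreover have "{1..<Suc n} = {1..n}" by auto
  ultimately show ?case using Suc.IH by (simp add: sum.distrib add_ac)
qed simp

fun fock_state :: "nat \<Rightarrow> nat set \<Rightarrow> nat set \<Rightarrow> site list" where
  "fock_state 0 J K = []"
| "fock_state (Suc n) J K =
     (if Suc n \<in> J then if Suc n \<in> K then SEF else SE else if Suc n \<in> K then SF else S0)
     # fock_state n J K"

fun occE :: "nat \<Rightarrow> site list \<Rightarrow> nat set" where
  "occE (Suc n) (x # xs) = (if x = SE \<or> x = SEF then insert (Suc n) (occE n xs) else occE n xs)"
| "occE _ _ = {}"

fun occF :: "nat \<Rightarrow> site list \<Rightarrow> nat set" where
  "occF (Suc n) (x # xs) = (if x = SF \<or> x = SEF then insert (Suc n) (occF n xs) else occF n xs)"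
| "occF _ _ = {}"

lemma occE_subset: "occE n s \<subseteq> {1..n}"
proof (induction n arbitrary: s)
  case (Suc n)
  have "{1..n} \<subseteq> {1..Suc n}" by auto
  then have "occE n xs \<subseteq> {1..Suc n}" for xs using Suc.IH by blast
  then show ?case by (cases s) simp_all
qed simp

lemma occF_subset: "occF n s \<subseteq> {1..n}"
proof (induction n arbitrary: s)
  case (Suc n)
  have "{1..n} \<subseteq> {1..Suc n}" by auto
  then have "occF n xs \<subseteq> {1..Suc n}" for xs using Suc.IH by blast
  then show ?case by (cases s) simp_all
qed simp

lemma Suc_notin_occE [simp]: "Suc n \<notin> occE n s" and Suc_notin_occF [simp]: "Suc n \<notin> occF n s"
  using occE_subset[of n s] occF_subset[of n s] by auto

lemma finite_occF [simp]: "finite (occF n s)"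
  using occF_subset finite_subset by blast

lemma occE_fock_state: "occE n (fock_state n J K) = J \<inter> {1..n}"
  by (induction n) (simp_all add: atLeastAtMostSuc_conv Int_insert_right)

lemma occF_fock_state: "occF n (fock_state n J K) = K \<inter> {1..n}"
  by (induction n) (simp_all add: atLeastAtMostSuc_conv Int_insert_right)

lemma fock_state_cong:
  "J \<inter> {1..n} = J' \<inter> {1..n} \<Longrightarrow> K \<inter> {1..n} = K' \<inter> {1..n} \<Longrightarrow> fock_state n J K = fock_state n J' K'"
proof (induction n)
  case (Suc n)
  have "Suc n \<in> J \<longleftrightarrow> Suc n \<in> J'" "Suc n \<in> K \<longleftrightarrow> Suc n \<in> K'"
    using Suc.prems by (metis IntD1 IntI atLeastAtMost_iff le_add1 order_refl plus_1_eq_Suc)+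
  moreover have "J \<inter> {1..n} = J \<inter> {1..Suc n} \<inter> {1..n}" for J by auto
  then have "fock_state n J K = fock_state n J' K'"
    using Suc.prems by (metis Suc.IH)
  ultimately show ?case by simp
qed simp

context quantum_scalars
begin

text \<open>One predicate for both families, so that sorting words and expanding into minors are
  done once and then used for \<open>opE\<close> and for \<open>opF\<close>.\<close>

definition qexterior :: "(nat \<Rightarrow> ('b \<Rightarrow> 'a) \<Rightarrow> 'b \<Rightarrow> 'a) \<Rightarrow> bool" where
  "qexterior op \<longleftrightarrow>
     (\<forall>j c v s. op j (\<lambda>s. c * v s) s = c * op j v s) \<and>
     (\<forall>j v w s. op j (\<lambda>s. v s + w s) s = op j v s + op j w s) \<and>
     (\<forall>j v s. op j (op j v) s = 0) \<and>
     (\<forall>j l v s. j < l \<longrightarrow> op l (op j v) s = - (q * op j (op l v) s))"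

lemma qexterior_opE: "qexterior (opE n)"
  by (auto simp: qexterior_def opE_scale opE_add opE_opE_same opE_opE)

lemma qexterior_opF: "qexterior (opF n)"
  by (auto simp: qexterior_def opF_scale opF_add opF_opF_same opF_opF)

context
  fixes op :: "nat \<Rightarrow> ('b \<Rightarrow> 'a) \<Rightarrow> 'b \<Rightarrow> 'a"
  assumes op: "qexterior op"
begin

lemma op_scale: "op j (\<lambda>s. c * v s) = (\<lambda>s. c * op j v s)"
  and op_add: "op j (\<lambda>s. v s + w s) = (\<lambda>s. op j v s + op j w s)"
  and op_same: "op j (op j v) = (\<lambda>s. 0)"
  and op_less: "j < l \<Longrightarrow> op l (op j v) = (\<lambda>s. (- q) * op j (op l v) s)"
  using op unfolding qexterior_def by (simp_all add: fun_eq_iff)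

lemma op_zero: "op j (\<lambda>s. 0) = (\<lambda>s. 0)"
  using op_scale[of j 0 "\<lambda>s. 0"] by simp

lemma op_sum: "op j (\<lambda>s. \<Sum>i\<in>I. v i s) = (\<lambda>s. \<Sum>i\<in>I. op j (v i) s)"
  by (induction I rule: infinite_finite_induct) (simp_all add: op_add op_zero)

lemma op_greater: "j < l \<Longrightarrow> op j (op l v) = (\<lambda>s. (- qi) * op l (op j v) s)"
  by (simp add: op_less)

lemma foldr_op_scale: "foldr op w (\<lambda>s. c * v s) = (\<lambda>s. c * foldr op w v s)"
  by (induction w) (simp_all add: op_scale)

lemma foldr_op_sum: "foldr op w (\<lambda>s. \<Sum>i\<in>I. v i s) = (\<lambda>s. \<Sum>i\<in>I. foldr op w (v i) s)"
  by (induction w) (simp_all add: op_sum)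

text \<open>The letter \<open>x\<close> moves right, past unequal letters at the cost of a unit,
  until it meets its copy and the square vanishes.\<close>

lemma op_foldr_mem: "x \<in> set xs \<Longrightarrow> op x (foldr op xs v) = (\<lambda>s. 0)"
proof (induction xs)
  case (Cons y ys)
  consider "x = y" | "x < y" | "y < x" by linarith
  then show ?case
  proof cases
    case 2
    then have "op x (foldr op ys v) = (\<lambda>s. 0)" using Cons by auto
    then show ?thesis using op_greater[OF 2] by (simp add: op_zero)
  next
    case 3
    then have "op x (foldr op ys v) = (\<lambda>s. 0)" using Cons by auto
    then show ?thesis using op_less[OF 3] by (simp add: op_zero)
  qed (simp add: op_same)
qed simp

lemma foldr_op_not_distinct: "\<not> distinct w \<Longrightarrow> foldr op w v = (\<lambda>s. 0)"
proof (induction w)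
  case (Cons x xs)
  then show ?case by (cases "distinct xs") (auto simp: op_foldr_mem op_zero)
qed simp

text \<open>Each smaller letter that \<open>x\<close> passes on the way to its place costs one
  factor \<open>- q\<close>.\<close>

lemma op_foldr_insort:
  "sorted ys \<Longrightarrow> distinct ys \<Longrightarrow> x \<notin> set ys \<Longrightarrow>
   op x (foldr op ys v) = (\<lambda>s. (- q) ^ card {y \<in> set ys. y < x} * foldr op (insort x ys) v s)"
proof (induction ys)
  case (Cons y ys)
  show ?case
  proof (cases "x < y")
    case True
    then have "{z \<in> set (y # ys). z < x} = {}" using Cons.prems by auto
    then have c: "card {z \<in> set (y # ys). z < x} = 0" by (simp only: card.empty)
    show ?thesis using True unfolding c by (simp add: order.strict_implies_order)
  next
    case False
    then have yx: "y < x" using Cons.prems by auto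
    have "{z \<in> set (y # ys). z < x} = insert y {z \<in> set ys. z < x}" using yx by auto
    then have c: "card {z \<in> set (y # ys). z < x} = Suc (card {z \<in> set ys. z < x})"
      using Cons.prems by simp
    show ?thesis using Cons yx unfolding c
      by (simp add: op_less op_scale mult.assoc)
  qed
qed simp

lemma foldr_op_sort:
  "distinct w \<Longrightarrow>
   foldr op w v = (\<lambda>s. (- q) ^ inversions w * foldr op (sorted_list_of_set (set w)) v s)"
proof (induction w)
  case (Cons x xs)
  let ?S = "sorted_list_of_set (set xs)"
  have "op x (foldr op ?S v)
      = (\<lambda>s. (- q) ^ card {y \<in> set xs. y < x} * foldr op (insort x ?S) v s)"
    using op_foldr_insort[of ?S x v] Cons.prems by simp
  moreover have "sorted_list_of_set (set (x # xs)) = insort x ?S"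
    using Cons.prems by simp
  moreover have "foldr op (x # xs) v = (\<lambda>s. (- q) ^ inversions xs * op x (foldr op ?S v) s)"
    using Cons by (simp add: op_scale)
  ultimately show ?case
    by (simp add: mult.assoc[symmetric] power_add[symmetric] add.commute)
qed simp

end

definition row_op :: "(nat \<Rightarrow> nat \<Rightarrow> 'a) \<Rightarrow> nat \<Rightarrow> (nat \<Rightarrow> ('b \<Rightarrow> 'a) \<Rightarrow> 'b \<Rightarrow> 'a) \<Rightarrow> nat
    \<Rightarrow> ('b \<Rightarrow> 'a) \<Rightarrow> 'b \<Rightarrow> 'a" where
  "row_op X n op i v = (\<lambda>s. \<Sum>j=1..n. X i j * op j v s)"

text \<open>The quantum minor, with a permutation written as the word of the columns it picks;
  \<open>qminor_eq_minor\<close> identifies it with \<open>qminor\<close>.\<close>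

definition minor :: "(nat \<Rightarrow> nat \<Rightarrow> 'a) \<Rightarrow> nat \<Rightarrow> nat set \<Rightarrow> 'a" where
  "minor X m J = (\<Sum>w\<in>permutations_of_set J.
     prod_list (map2 X [1..<Suc m] w) * (- q) ^ inversions w)"

lemma foldr_row_op_words:
  assumes "qexterior op"
  shows "foldr (row_op X n op) rs v = (\<lambda>s. \<Sum>w\<in>{w. set w \<subseteq> {1..n} \<and> length w = length rs}.
            prod_list (map2 X rs w) * foldr op w v s)"
proof (induction rs)
  case Nil
  have "{w. set w \<subseteq> {1..n} \<and> length w = length ([]::nat list)} = {[]}" by auto
  then show ?case by simp
next
  case (Cons r rs)
  let ?W = "{w. set w \<subseteq> {1..n} \<and> length w = length rs}"
  have inj: "inj_on (\<lambda>(xs, n). n # xs) (?W \<times> {1..n})" by (auto simp: inj_on_def)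
  have "foldr (row_op X n op) (r # rs) v
      = (\<lambda>s. \<Sum>j=1..n. \<Sum>w\<in>?W. X r j * (prod_list (map2 X rs w) * op j (foldr op w v) s))"
    by (simp add: Cons row_op_def op_sum[OF assms] op_scale[OF assms] sum_distrib_left)
  also have "\<dots> = (\<lambda>s. \<Sum>w\<in>?W. \<Sum>j=1..n. X r j * (prod_list (map2 X rs w) * op j (foldr op w v) s))"
    by (subst sum.swap) simp
  also have "\<dots> = (\<lambda>s. \<Sum>w\<in>{w. set w \<subseteq> {1..n} \<and> length w = length (r # rs)}.
            prod_list (map2 X (r # rs) w) * foldr op w v s)"
    unfolding list.size(4) add_Suc_right add_0_right lists_length_Suc_eq sum.reindex[OF inj]
    by (simp add: sum.cartesian_product mult.assoc comp_def case_prod_unfold)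
  finally show ?case .
qed

text \<open>Words with a repeated letter vanish. The others are grouped by their set of letters
  \<open>J\<close>, and sorting a word yields the power of \<open>- q\<close> that it carries in
  \<open>minor X m J\<close>.\<close>

lemma foldr_row_op:
  assumes "qexterior op"
  shows "foldr (row_op X n op) [1..<Suc m] v
       = (\<lambda>s. \<Sum>J\<in>Pi_mn m n. minor X m J * foldr op (sorted_list_of_set J) v s)"
proof
  fix s
  let ?W = "{w. set w \<subseteq> {1..n} \<and> length w = m}"
  let ?D = "{w \<in> ?W. distinct w}"
  let ?g = "\<lambda>w. prod_list (map2 X [1..<Suc m] w) * foldr op w v s"
  have fin: "finite ?W" using finite_lists_length_eq[of "{1..n}" m] by simp
  have D: "?D = (\<Union>J\<in>Pi_mn m n. permutations_of_set J)"
    using finite_of_Pi_mn[of _ m n] by (auto simp: Pi_mn_def permutations_of_set_def distinct_card)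
  have "foldr (row_op X n op) [1..<Suc m] v s = (\<Sum>w\<in>?W. ?g w)"
    using foldr_row_op_words[OF assms, of X n "[1..<Suc m]" v] by (simp del: upt_Suc)
  also have "\<dots> = (\<Sum>w\<in>?D. ?g w)"
    using fin by (intro sum.mono_neutral_right) (auto simp: foldr_op_not_distinct[OF assms])
  also have "\<dots> = (\<Sum>J\<in>Pi_mn m n. \<Sum>w\<in>permutations_of_set J. ?g w)"
    unfolding D
  proof (rule sum.UNION_disjoint)
    show "finite (Pi_mn m n)" by (rule finite_Pi_mn)
    show "\<forall>J\<in>Pi_mn m n. finite (permutations_of_set J)" by simp
  qed (auto simp: permutations_of_set_def)
  also have "\<dots> = (\<Sum>J\<in>Pi_mn m n. minor X m J * foldr op (sorted_list_of_set J) v s)"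
  proof (rule sum.cong)
    fix J
    have "?g w = prod_list (map2 X [1..<Suc m] w) * (- q) ^ inversions w
             * foldr op (sorted_list_of_set J) v s" if "w \<in> permutations_of_set J" for w
      using that foldr_op_sort[OF assms, of w v] by (simp add: permutations_of_set_def mult.assoc)
    then show "(\<Sum>w\<in>permutations_of_set J. ?g w) = minor X m J * foldr op (sorted_list_of_set J) v s"
      by (simp add: minor_def sum_distrib_right cong: sum.cong)
  qed simp
  finally show "foldr (row_op X n op) [1..<Suc m] v s
     = (\<Sum>J\<in>Pi_mn m n. minor X m J * foldr op (sorted_list_of_set J) v s)" .
qed

section \<open>Supports and leading coefficients\<close>

lemma opE_support:
  "opE n j v s \<noteq> 0 \<Longrightarrow> \<exists>s'. v s' \<noteq> 0 \<and> occE n s = insert j (occE n s') \<and> occF n s = occF n s'"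
proof (induction n arbitrary: v s)
  case (Suc n)
  then obtain x xs where s: "s = x # xs" by (cases s) auto
  show ?case
  proof (cases "j = Suc n")
    case True
    then show ?thesis using Suc.prems s by (cases x) (auto intro: exI[of _ "S0 # xs"] exI[of _ "SF # xs"])
  next
    case False
    then have "opE n j (\<lambda>ys. v (x # ys)) xs \<noteq> 0" using Suc.prems s by auto
    from Suc.IH[OF this] obtain ys where "v (x # ys) \<noteq> 0" "occE n xs = insert j (occE n ys)"
      "occF n xs = occF n ys" by blast
    then show ?thesis using s by (intro exI[of _ "x # ys"]) (auto simp: insert_commute)
  qed
qed simp

text \<open>The second alternative comes from the summand of \<open>opF\<close> with
  \<open>opE\<close>: an \<open>e\<close> is created in column \<open>j\<close> and an
  \<open>e\<close> in a later column \<open>l\<close> becomes an \<open>f\<close>. So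
  \<open>f_j\<close> always adds an index at least \<open>j\<close> to the second set, which is the
  source of the order on index sets.\<close>

lemma opF_support:
  "opF n j v s \<noteq> 0 \<Longrightarrow> \<exists>s'. v s' \<noteq> 0 \<and>
     (occE n s = occE n s' \<and> occF n s = insert j (occF n s') \<and> j \<notin> occF n s' \<or>
      (\<exists>l>j. l \<in> occE n s' \<and> l \<notin> occF n s' \<and> occF n s = insert l (occF n s')))"
proof (induction n arbitrary: v s)
  case (Suc n)
  then obtain x xs where s: "s = x # xs" by (cases s) auto
  show ?case
  proof (cases "j = Suc n")
    case True
    then show ?thesis using Suc.prems s by (cases x) (auto intro: exI[of _ "S0 # xs"] exI[of _ "SE # xs"])
  next
    case False
    then consider "opF n j (\<lambda>ys. v (x # ys)) xs \<noteq> 0" | "x = SF" "opE n j (\<lambda>ys. v (SE # ys)) xs \<noteq> 0"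
      using Suc.prems s
      by (cases "opF n j (\<lambda>ys. v (x # ys)) xs = 0"; cases "opE n j (\<lambda>ys. v (SE # ys)) xs = 0")
         (auto split: if_splits)
    then show ?thesis
    proof cases
      case 1
      from Suc.IH[OF this] obtain ys where ys: "v (x # ys) \<noteq> 0"
        "occE n xs = occE n ys \<and> occF n xs = insert j (occF n ys) \<and> j \<notin> occF n ys \<or>
         (\<exists>l>j. l \<in> occE n ys \<and> l \<notin> occF n ys \<and> occF n xs = insert l (occF n ys))" by blast
      have "l \<noteq> Suc n" if "l \<in> occE n ys" for l using that by auto
      then show ?thesis using s ys False
        by (intro exI[of _ "x # ys"]) (auto simp: insert_commute)
    next
      case 2
      from opE_support[OF this(2)] obtain ys where ys: "v (SE # ys) \<noteq> 0"
        "occE n xs = insert j (occE n ys)" "occF n xs = occF n ys" by blast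
      \<comment> \<open>The later column is \<open>Suc n\<close>, whose site changes from
        \<open>SE\<close> to \<open>SF\<close>.\<close>
      have "j < Suc n" using occE_subset[of n xs] ys(2) by auto
      then show ?thesis using ys s 2(1)
        by (intro exI[of _ "SE # ys"]) auto
    qed
  qed
qed simp

end

text \<open>Counting how many elements reach each threshold \<open>t\<close> determines the
  componentwise order, and such counts can be followed one operator at a time.\<close>

lemma st_leI_card:
  assumes I: "I \<in> Pi_mn m n" and J: "J \<in> Pi_mn m n"
    and le: "\<And>t. card {k \<in> I. t \<le> k} \<le> card {k \<in> J. t \<le> k}"
  shows "st_le m I J"
proof (rule ccontr)
  define xs ys where "xs = sorted_list_of_set I" and "ys = sorted_list_of_set J"
  have fin: "finite I" "finite J" using I J by (auto intro: finite_of_Pi_mn)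
  have xs: "set xs = I" "length xs = m" "sorted xs" "distinct xs"
    using I fin by (simp_all add: xs_def Pi_mn_def)
  have ys: "set ys = J" "length ys = m" "sorted ys" "distinct ys"
    using J fin by (simp_all add: ys_def Pi_mn_def)
  have count: "card {k \<in> set zs. t \<le> k} = card {i. i < length zs \<and> t \<le> zs ! i}"
    if "distinct zs" for zs :: "nat list" and t
  proof -
    have "card {k \<in> set zs. t \<le> k} = length (filter ((\<le>) t) zs)"
      using distinct_card[of "filter ((\<le>) t) zs"] that by simp
    then show ?thesis by (simp add: length_filter_conv_card)
  qed
  assume "\<not> st_le m I J"
  then obtain s where s: "1 \<le> s" "s \<le> m" "ys ! (s - 1) < xs ! (s - 1)"
    by (auto simp: st_le_def jth_def xs_def ys_def not_le)
  \<comment> \<open>With the \<open>s\<close>-th element of \<open>I\<close> as threshold,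
    \<open>I\<close> has at least \<open>m - (s - 1)\<close> elements reaching it, but
    \<open>J\<close> at most \<open>m - s\<close>.\<close>
  define t where "t = xs ! (s - 1)"
  have "{s - 1..<m} \<subseteq> {i. i < length xs \<and> t \<le> xs ! i}"
    using xs s by (auto simp: t_def sorted_nth_mono)
  then have "m - (s - 1) \<le> card {i. i < length xs \<and> t \<le> xs ! i}"
    using card_mono[of "{i. i < length xs \<and> t \<le> xs ! i}" "{s - 1..<m}"] by simp
  moreover have "{i. i < length ys \<and> t \<le> ys ! i} \<subseteq> {s..<m}"
  proof safe
    fix i assume i: "i < length ys" "t \<le> ys ! i"
    have "s - 1 < length ys" using s ys by simp
    then have "\<not> i \<le> s - 1"
      using sorted_nth_mono[OF ys(3), of i "s - 1"] s i unfolding t_def by linarith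
    then show "i \<in> {s..<m}" using i ys by auto
  qed
  then have "card {i. i < length ys \<and> t \<le> ys ! i} \<le> m - s"
    using card_mono[of "{s..<m}"] by fastforce
  ultimately show False
    using le[of t] count[OF xs(4), of t] count[OF ys(4), of t] xs(1) ys(1) s by simp
qed

lemma st_le_trans: "st_le m I J \<Longrightarrow> st_le m J K \<Longrightarrow> st_le m I K"
  unfolding st_le_def using order_trans by blast

context quantum_scalars
begin

text \<open>Additive subgroups stable under the scalars that occur in the operators. It is applied
  to the ideal, so that operators respect congruence, and to the constants, so that the coefficients
  of the commutation relation are scalars.\<close>

definition scalar_stable :: "'a set \<Rightarrow> bool" where
  "scalar_stable M \<longleftrightarrow> 0 \<in> M \<and> (\<forall>x\<in>M. \<forall>y\<in>M. x + y \<in> M) \<and>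
     (\<forall>x\<in>M. - x \<in> M \<and> q * x \<in> M \<and> qi * x \<in> M)"

lemma scalar_stableD:
  assumes "scalar_stable M"
  shows "0 \<in> M" "\<And>x y. x \<in> M \<Longrightarrow> y \<in> M \<Longrightarrow> x + y \<in> M" "\<And>x. x \<in> M \<Longrightarrow> - x \<in> M"
    "\<And>x. x \<in> M \<Longrightarrow> q * x \<in> M" "\<And>x. x \<in> M \<Longrightarrow> qi * x \<in> M"
  using assms by (auto simp: scalar_stable_def)

lemma opE_closed:
  assumes "scalar_stable M" and v: "\<And>s. v s \<in> M"
  shows "opE n j v s \<in> M"
  using v
proof (induction n arbitrary: v s)
  case (Suc n)
  note M = scalar_stableD[OF assms(1)]
  have "kE x * y \<in> M" if "y \<in> M" for x y using that M by (cases x) simp_all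
  then show ?case using Suc M by (cases s) (auto split: site.split)
qed (use scalar_stableD[OF assms(1)] in simp)

lemma opF_closed:
  assumes "scalar_stable M" and v: "\<And>s. v s \<in> M"
  shows "opF n j v s \<in> M"
  using v
proof (induction n arbitrary: v s)
  case (Suc n)
  note M = scalar_stableD[OF assms(1)]
  have "kF x * y \<in> M" if "y \<in> M" for x y using that M by (cases x) simp_all
  moreover have "(q - qi) * y \<in> M" if "y \<in> M" for y
    using M(2)[OF M(4)[OF that] M(3)[OF M(5)[OF that]]] by (simp add: left_diff_distrib)
  moreover have "opE n j w s \<in> M" if "\<And>s. w s \<in> M" for w s using opE_closed[OF assms(1) that] .
  ultimately show ?case using Suc M by (cases s) (auto split: site.split)
qed (use scalar_stableD[OF assms(1)] in simp)

lemma foldr_opE_support: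
  "foldr (opE n) w v s \<noteq> 0 \<Longrightarrow>
   \<exists>s'. v s' \<noteq> 0 \<and> occE n s = set w \<union> occE n s' \<and> occF n s = occF n s'"
proof (induction w arbitrary: s)
  case (Cons x w)
  then obtain s' where "foldr (opE n) w v s' \<noteq> 0" "occE n s = insert x (occE n s')" "occF n s = occF n s'"
    using opE_support by fastforce
  then show ?case using Cons.IH[of s'] by auto
qed auto

text \<open>As \<open>v\<close> has no \<open>e\<close> occupied, the alternative of
  \<open>opF_support\<close> that consumes an \<open>e\<close> never occurs.\<close>

lemma foldr_opF_support:
  assumes "\<And>s. v s \<noteq> 0 \<Longrightarrow> occE n s = {}"
  shows "foldr (opF n) w v s \<noteq> 0 \<Longrightarrow>
    \<exists>s'. v s' \<noteq> 0 \<and> occE n s = {} \<and> occF n s = set w \<union> occF n s'"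
proof (induction w arbitrary: s)
  case (Cons x w)
  then obtain s' where "foldr (opF n) w v s' \<noteq> 0"
    "occE n s = occE n s' \<and> occF n s = insert x (occF n s') \<or> occE n s' \<noteq> {}"
    using opF_support[of n x "foldr (opF n) w v" s] by auto
  then show ?case using Cons.IH[of s'] by auto
qed (use assms in auto)

text \<open>Each letter \<open>x\<close> adds a new element that is at least \<open>x\<close>, so it
  raises the count of elements reaching \<open>t\<close> whenever \<open>x\<close> itself reaches
  \<open>t\<close>.\<close>

lemma foldr_opF_count:
  "foldr (opF n) w v s \<noteq> 0 \<Longrightarrow>
   \<exists>s'. v s' \<noteq> 0 \<and> length (filter ((\<le>) t) w) + card {k \<in> occF n s'. t \<le> k} \<le> card {k \<in> occF n s. t \<le> k}"
proof (induction w arbitrary: s)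
  case (Cons x w)
  then obtain s' l where s': "foldr (opF n) w v s' \<noteq> 0" and l: "l \<ge> x" "l \<notin> occF n s'"
    and eq: "occF n s = insert l (occF n s')"
    using opF_support[of n x "foldr (opF n) w v" s] by (auto intro: less_imp_le)
  have "(if t \<le> x then 1 else 0) + card {k \<in> occF n s'. t \<le> k} \<le> card {k \<in> occF n s. t \<le> k}"
  proof (cases "t \<le> x")
    case True
    then have "{k \<in> occF n s. t \<le> k} = insert l {k \<in> occF n s'. t \<le> k}" using eq l by auto
    then show ?thesis using True l by simp
  next
    case False
    then show ?thesis using eq by (auto intro: card_mono)
  qed
  then show ?case using Cons.IH[OF s'] by fastforce
qed auto

text \<open>Only one preimage is possible, and each element of \<open>J\<close> beyond
  \<open>j\<close> contributes a factor \<open>- qi\<close> through \<open>kE\<close>. The exponent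
  is the same for all \<open>v\<close>, which allows iteration along a word.\<close>

lemma opE_fock_state:
  "j \<in> J \<Longrightarrow> j \<in> {1..n} \<Longrightarrow>
   \<exists>k. \<forall>v. opE n j v (fock_state n J K) = (- qi) ^ k * v (fock_state n (J - {j}) K)"
proof (induction n)
  case (Suc n)
  show ?case
  proof (cases "j = Suc n")
    case True
    have "fock_state n (J - {Suc n}) K = fock_state n J K" by (rule fock_state_cong) auto
    then show ?thesis using True Suc.prems by (intro exI[of _ 0]) simp
  next
    case False
    then obtain k where k: "\<And>v. opE n j v (fock_state n J K) = (- qi) ^ k * v (fock_state n (J - {j}) K)"
      using Suc by auto
    show ?thesis
    proof (cases "Suc n \<in> J")
      case True
      then show ?thesis using False by (intro exI[of _ "Suc k"]) (simp add: k mult.assoc)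
    next
      case F: False
      then show ?thesis using False by (intro exI[of _ k]) (simp add: k)
    qed
  qed
qed simp

lemma foldr_opE_fock_state:
  "distinct w \<Longrightarrow> set w \<subseteq> J \<inter> {1..n} \<Longrightarrow>
   \<exists>k. \<forall>v. foldr (opE n) w v (fock_state n J K) = (- qi) ^ k * v (fock_state n (J - set w) K)"
proof (induction w arbitrary: J)
  case Nil
  show ?case by (intro exI[of _ 0]) simp
next
  case (Cons x w)
  obtain k where k: "\<And>v. opE n x v (fock_state n J K) = (- qi) ^ k * v (fock_state n (J - {x}) K)"
    using opE_fock_state[of x J n K] Cons.prems by auto
  obtain l where l: "\<And>v. foldr (opE n) w v (fock_state n (J - {x}) K)
      = (- qi) ^ l * v (fock_state n (J - {x} - set w) K)"
    using Cons.IH[of "J - {x}"] Cons.prems by auto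
  have "J - set (x # w) = J - {x} - set w" by auto
  then show ?case by (intro exI[of _ "k + l"]) (simp add: k l power_add mult.assoc)
qed

text \<open>The first set is empty, so the summand of \<open>opF\<close> with \<open>opE\<close>
  vanishes: it would leave an \<open>e\<close> in column \<open>j\<close>.\<close>

lemma opF_fock_state:
  "j \<in> K \<Longrightarrow> j \<in> {1..n} \<Longrightarrow>
   \<exists>k. \<forall>v. opF n j v (fock_state n {} K) = (- qi) ^ k * v (fock_state n {} (K - {j}))"
proof (induction n)
  case (Suc n)
  show ?case
  proof (cases "j = Suc n")
    case True
    have "fock_state n {} (K - {Suc n}) = fock_state n {} K" by (rule fock_state_cong) auto
    then show ?thesis using True Suc.prems by (intro exI[of _ 0]) simp
  next
    case False
    then obtain k where k: "\<And>v. opF n j v (fock_state n {} K) = (- qi) ^ k * v (fock_state n {} (K - {j}))"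
      using Suc by auto
    have "opE n j v (fock_state n {} K) = 0" for v
      using opE_support[of n j v "fock_state n {} K"] by (auto simp: occE_fock_state)
    then show ?thesis
    proof (cases "Suc n \<in> K")
      case True
      then show ?thesis using False \<open>\<And>v. opE n j v (fock_state n {} K) = 0\<close>
        by (intro exI[of _ "Suc k"]) (simp add: k mult.assoc)
    next
      case F: False
      then show ?thesis using False by (intro exI[of _ k]) (simp add: k)
    qed
  qed
qed simp

lemma foldr_opF_fock_state:
  "distinct w \<Longrightarrow> set w \<subseteq> K \<inter> {1..n} \<Longrightarrow>
   \<exists>k. \<forall>v. foldr (opF n) w v (fock_state n {} K) = (- qi) ^ k * v (fock_state n {} (K - set w))"
proof (induction w arbitrary: K)
  case Nil
  show ?case by (intro exI[of _ 0]) simp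
next
  case (Cons x w)
  obtain k where k: "\<And>v. opF n x v (fock_state n {} K) = (- qi) ^ k * v (fock_state n {} (K - {x}))"
    using opF_fock_state[of x K n] Cons.prems by auto
  obtain l where l: "\<And>v. foldr (opF n) w v (fock_state n {} (K - {x}))
      = (- qi) ^ l * v (fock_state n {} (K - {x} - set w))"
    using Cons.IH[of "K - {x}"] Cons.prems by auto
  have "K - set (x # w) = K - {x} - set w" by auto
  then show ?case by (intro exI[of _ "k + l"]) (simp add: k l power_add mult.assoc)
qed

definition vacuum :: "nat \<Rightarrow> site list \<Rightarrow> 'a" where
  "vacuum n s = (if s = fock_state n {} {} then 1 else 0)"

lemma vacuum_support: "vacuum n s \<noteq> 0 \<Longrightarrow> occE n s = {} \<and> occF n s = {}"
  by (auto simp: vacuum_def occE_fock_state occF_fock_state split: if_splits)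

end

section \<open>The commutation relation for minors\<close>

text \<open>No quotient ring is formed: the relations of the entries are imposed as membership in a
  two-sided ideal \<open>I\<close>, later instantiated by \<open>qmat_ideal\<close> in the free
  algebra.\<close>

locale quantum_matrices = quantum_scalars q qi for q qi :: "'a::ring_1" +
  fixes X :: "nat \<Rightarrow> nat \<Rightarrow> 'a" and m n :: nat and I :: "'a set"
  assumes ideal_zero: "0 \<in> I" and ideal_add: "x \<in> I \<Longrightarrow> y \<in> I \<Longrightarrow> x + y \<in> I"
    and ideal_lmul: "x \<in> I \<Longrightarrow> a * x \<in> I" and ideal_rmul: "x \<in> I \<Longrightarrow> x * a \<in> I"
    and rel_row: "1 \<le> i \<Longrightarrow> i \<le> m \<Longrightarrow> 1 \<le> j \<Longrightarrow> j < l \<Longrightarrow> l \<le> n \<Longrightarrow>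
       X i j * X i l - q * (X i l * X i j) \<in> I"
    and rel_col: "1 \<le> i \<Longrightarrow> i < k \<Longrightarrow> k \<le> m \<Longrightarrow> 1 \<le> j \<Longrightarrow> j \<le> n \<Longrightarrow>
       X i j * X k j - q * (X k j * X i j) \<in> I"
    and rel_anti: "1 \<le> i \<Longrightarrow> i < k \<Longrightarrow> k \<le> m \<Longrightarrow> 1 \<le> j \<Longrightarrow> j < l \<Longrightarrow> l \<le> n \<Longrightarrow>
       X k j * X i l - X i l * X k j \<in> I"
    and rel_diag: "1 \<le> i \<Longrightarrow> i < k \<Longrightarrow> k \<le> m \<Longrightarrow> 1 \<le> j \<Longrightarrow> j < l \<Longrightarrow> l \<le> n \<Longrightarrow>
       X i j * X k l - X k l * X i j - (q - qi) * (X i l * X k j) \<in> I"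
begin

section \<open>Congruence of Fock vectors modulo the ideal\<close>

lemma ideal_uminus: "x \<in> I \<Longrightarrow> - x \<in> I"
  using ideal_lmul[of x "-1"] by simp

lemma ideal_diff: "x \<in> I \<Longrightarrow> y \<in> I \<Longrightarrow> x - y \<in> I"
  using ideal_add[of x "- y"] ideal_uminus by simp

lemma ideal_scalar_stable: "scalar_stable I"
  by (simp add: scalar_stable_def ideal_zero ideal_add ideal_lmul ideal_uminus)

lemma ideal_sum: "(\<And>x. x \<in> S \<Longrightarrow> f x \<in> I) \<Longrightarrow> sum f S \<in> I"
  by (induction S rule: infinite_finite_induct) (auto intro: ideal_zero ideal_add)

lemma ideal_double_sum:
  assumes "\<And>j. j \<in> {1..n} \<Longrightarrow> g j j \<in> I"
    and "\<And>j l. 1 \<le> j \<Longrightarrow> j < l \<Longrightarrow> l \<le> n \<Longrightarrow> g j l + g l j \<in> I"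
  shows "(\<Sum>j=1..n. \<Sum>l=1..n. g j l) \<in> I"
  unfolding double_sum_triangle by (rule ideal_add; intro ideal_sum assms) auto

definition vcong :: "('b \<Rightarrow> 'a) \<Rightarrow> ('b \<Rightarrow> 'a) \<Rightarrow> bool" (infix "\<approx>" 50) where
  "v \<approx> w \<longleftrightarrow> (\<forall>s. v s - w s \<in> I)"

lemma vcong_refl [simp]: "v \<approx> v"
  by (simp add: vcong_def ideal_zero)

lemma vcong_sym: "v \<approx> w \<Longrightarrow> w \<approx> v"
  using ideal_uminus unfolding vcong_def by (metis minus_diff_eq)

lemma vcong_trans [trans]: "u \<approx> v \<Longrightarrow> v \<approx> w \<Longrightarrow> u \<approx> w"
  using ideal_add unfolding vcong_def by (metis diff_add_cancel add_diff_eq)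

lemma vcong_scale: "v \<approx> w \<Longrightarrow> (\<lambda>s. c * v s) \<approx> (\<lambda>s. c * w s)"
  using ideal_lmul unfolding vcong_def by (metis right_diff_distrib)

definition omega :: "nat \<Rightarrow> (site list \<Rightarrow> 'a) \<Rightarrow> site list \<Rightarrow> 'a" where
  "omega = row_op X n (opE n)"

definition eta :: "nat \<Rightarrow> (site list \<Rightarrow> 'a) \<Rightarrow> site list \<Rightarrow> 'a" where
  "eta = row_op X n (opF n)"

lemma omega_cong: "v \<approx> w \<Longrightarrow> omega i v \<approx> omega i w"
  unfolding vcong_def omega_def row_op_def
proof
  fix s assume vw: "\<forall>s. v s - w s \<in> I"
  have "opE n j (\<lambda>s. v s - w s) s \<in> I" for j
    by (rule opE_closed[OF ideal_scalar_stable]) (use vw in auto)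
  then have "(\<Sum>j=1..n. X i j * opE n j (\<lambda>s. v s - w s) s) \<in> I"
    by (intro ideal_sum ideal_lmul) auto
  then show "(\<Sum>j=1..n. X i j * opE n j v s) - (\<Sum>j=1..n. X i j * opE n j w s) \<in> I"
    by (simp add: opE_diff right_diff_distrib sum_subtractf)
qed

lemma eta_cong: "v \<approx> w \<Longrightarrow> eta i v \<approx> eta i w"
  unfolding vcong_def eta_def row_op_def
proof
  fix s assume vw: "\<forall>s. v s - w s \<in> I"
  have "opF n j (\<lambda>s. v s - w s) s \<in> I" for j
    by (rule opF_closed[OF ideal_scalar_stable]) (use vw in auto)
  then have "(\<Sum>j=1..n. X i j * opF n j (\<lambda>s. v s - w s) s) \<in> I"
    by (intro ideal_sum ideal_lmul) auto
  then show "(\<Sum>j=1..n. X i j * opF n j v s) - (\<Sum>j=1..n. X i j * opF n j w s) \<in> I"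
    by (simp add: opF_diff right_diff_distrib sum_subtractf)
qed

lemma omega_omega: "omega i (omega k v) s = (\<Sum>j=1..n. \<Sum>l=1..n. X i j * (X k l * opE n j (opE n l v) s))"
  by (simp add: omega_def row_op_def opE_sum opE_scale sum_distrib_left)

lemma omega_eta: "omega i (eta k v) s = (\<Sum>j=1..n. \<Sum>l=1..n. X i j * (X k l * opE n j (opF n l v) s))"
  by (simp add: omega_def eta_def row_op_def opE_sum opE_scale sum_distrib_left)

lemma eta_omega: "eta i (omega k v) s = (\<Sum>j=1..n. \<Sum>l=1..n. X i j * (X k l * opF n j (opE n l v) s))"
  by (simp add: omega_def eta_def row_op_def opF_sum opF_scale sum_distrib_left)

lemma X_q [simp]: "X i j * (q * y) = q * (X i j * y)" "X i j * (qi * y) = qi * (X i j * y)"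
  by (simp_all add: q_left_commute)

lemma omega_scale: "omega i (\<lambda>s. q * v s) = (\<lambda>s. q * omega i v s)"
  by (simp add: omega_def row_op_def opE_scale sum_distrib_left)

lemma omega_scale_diff: "omega i (\<lambda>s. (q - qi) * v s) = (\<lambda>s. (q - qi) * omega i v s)"
  by (simp add: omega_def row_op_def opE_scale opE_diff sum_distrib_left left_diff_distrib right_diff_distrib)

lemma omega_add: "omega i (\<lambda>s. v s + w s) = (\<lambda>s. omega i v s + omega i w s)"
  by (simp add: omega_def row_op_def opE_add sum.distrib distrib_left)

lemma eta_scale: "eta i (\<lambda>s. q * v s) = (\<lambda>s. q * eta i v s)"
  by (simp add: eta_def row_op_def opF_scale sum_distrib_left)

section \<open>Exchange relations of the row operators modulo the ideal\<close>

lemma omega_same: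
  assumes "1 \<le> i" "i \<le> m"
  shows "omega i (omega i v) \<approx> (\<lambda>s. 0)"
  unfolding vcong_def
proof
  fix s
  have "(\<Sum>j=1..n. \<Sum>l=1..n. X i j * (X i l * opE n j (opE n l v) s)) \<in> I"
  proof (rule ideal_double_sum)
    fix j l :: nat assume jl: "1 \<le> j" "j < l" "l \<le> n"
    have "(X i j * X i l - q * (X i l * X i j)) * opE n j (opE n l v) s \<in> I"
      using rel_row assms jl by (intro ideal_rmul) auto
    then show "X i j * (X i l * opE n j (opE n l v) s) + X i l * (X i j * opE n l (opE n j v) s) \<in> I"
      by (simp add: opE_opE[OF jl(2)] algebra_simps)
  qed (simp add: opE_opE_same ideal_zero)
  then show "omega i (omega i v) s - 0 \<in> I" by (simp add: omega_omega)
qed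

text \<open>Modulo \<open>I\<close> the operators \<open>omega\<close> obey in the row index the
  rule that the \<open>e\<close> obey in the column index. Each pair \<open>j < l\<close> gives a
  combination of \<open>rel_diag\<close> and \<open>rel_anti\<close>.\<close>

lemma omega_swap:
  assumes "1 \<le> i" "i < k" "k \<le> m"
  shows "omega i (omega k v) \<approx> (\<lambda>s. - (qi * omega k (omega i v) s))"
  unfolding vcong_def
proof
  fix s
  let ?g = "\<lambda>j l. X i j * (X k l * opE n j (opE n l v) s) + qi * (X k j * (X i l * opE n j (opE n l v) s))"
  have "(\<Sum>j=1..n. \<Sum>l=1..n. ?g j l) \<in> I"
  proof (rule ideal_double_sum)
    fix j l :: nat assume jl: "1 \<le> j" "j < l" "l \<le> n"
    let ?u = "opE n j (opE n l v) s"
    have "(X i j * X k l - X k l * X i j - (q - qi) * (X i l * X k j)) * ?u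
        + (qi * (X k j * X i l - X i l * X k j)) * ?u \<in> I"
      using rel_diag rel_anti assms jl by (intro ideal_rmul ideal_lmul ideal_add) auto
    then show "?g j l + ?g l j \<in> I"
      by (simp add: opE_opE[OF jl(2)] algebra_simps)
  qed (simp add: opE_opE_same ideal_zero)
  then show "omega i (omega k v) s - - (qi * omega k (omega i v) s) \<in> I"
    by (simp add: omega_omega sum.distrib sum_distrib_left)
qed

lemma eta_omega_same:
  assumes "1 \<le> i" "i \<le> m"
  shows "eta i (omega i v) \<approx> (\<lambda>s. q * omega i (eta i v) s)"
  unfolding vcong_def
proof
  fix s
  let ?g = "\<lambda>j l. X i j * (X i l * opF n j (opE n l v) s) - q * (X i j * (X i l * opE n j (opF n l v) s))"
  have "(\<Sum>j=1..n. \<Sum>l=1..n. ?g j l) \<in> I"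
  proof (rule ideal_double_sum)
    fix j l :: nat assume jl: "1 \<le> j" "j < l" "l \<le> n"
    \<comment> \<open>Once all products have \<open>e\<close> before \<open>f\<close>, both orders
      of the columns share the right factor
      \<open>opE n l (opF n j v) s - qi * opE n j (opF n l v) s\<close>.\<close>
    have "(X i j * X i l - q * (X i l * X i j)) * (opE n l (opF n j v) s - qi * opE n j (opF n l v) s) \<in> I"
      using rel_row assms jl by (intro ideal_rmul) auto
    then show "?g j l + ?g l j \<in> I"
      by (simp add: opF_opE_less[OF jl(2)] opF_opE_greater[OF jl(2)] algebra_simps)
  qed (simp add: opF_opE_same ideal_zero)
  then show "eta i (omega i v) s - q * omega i (eta i v) s \<in> I"
    by (simp add: eta_omega omega_eta sum_subtractf sum_distrib_left)
qed

lemma eta_omega_greater: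
  assumes "1 \<le> i" "i < k" "k \<le> m"
  shows "eta k (omega i v) \<approx> omega i (eta k v)"
  unfolding vcong_def
proof
  fix s
  let ?g = "\<lambda>j l. X k j * (X i l * opF n j (opE n l v) s) - X i j * (X k l * opE n j (opF n l v) s)"
  have "(\<Sum>j=1..n. \<Sum>l=1..n. ?g j l) \<in> I"
  proof (rule ideal_double_sum)
    fix j :: nat assume j: "j \<in> {1..n}"
    have "- ((X i j * X k j - q * (X k j * X i j)) * opE n j (opF n j v) s) \<in> I"
      using rel_col assms j by (intro ideal_rmul ideal_uminus) auto
    then show "?g j j \<in> I" by (simp add: opF_opE_same algebra_simps)
  next
    fix j l :: nat assume jl: "1 \<le> j" "j < l" "l \<le> n"
    have "- ((X i j * X k l - X k l * X i j - (q - qi) * (X i l * X k j)) * opE n j (opF n l v) s)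
        + (X k j * X i l - X i l * X k j) * (opE n l (opF n j v) s + (q - qi) * opE n j (opF n l v) s) \<in> I"
      using rel_diag rel_anti assms jl by (intro ideal_rmul ideal_uminus ideal_add) auto
    then show "?g j l + ?g l j \<in> I"
      by (simp add: opF_opE_less[OF jl(2)] opF_opE_greater[OF jl(2)] algebra_simps)
  qed
  then show "eta k (omega i v) s - omega i (eta k v) s \<in> I"
    by (simp add: eta_omega omega_eta sum_subtractf)
qed

text \<open>The analogue of \<open>opF_opE_greater\<close> for rows. After
  \<open>opF_opE_same\<close> the diagonal terms are multiples of the column relation.\<close>

lemma eta_omega_less:
  assumes "1 \<le> i" "i < k" "k \<le> m"
  shows "eta i (omega k v) \<approx> (\<lambda>s. omega k (eta i v) s + (q - qi) * omega i (eta k v) s)"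
  unfolding vcong_def
proof
  fix s
  let ?g = "\<lambda>j l. X i j * (X k l * opF n j (opE n l v) s) - (X k j * (X i l * opE n j (opF n l v) s)
     + (q - qi) * (X i j * (X k l * opE n j (opF n l v) s)))"
  have "(\<Sum>j=1..n. \<Sum>l=1..n. ?g j l) \<in> I"
  proof (rule ideal_double_sum)
    fix j :: nat assume j: "j \<in> {1..n}"
    have "(qi * (X i j * X k j - q * (X k j * X i j))) * opE n j (opF n j v) s \<in> I"
      using rel_col assms j by (intro ideal_rmul ideal_lmul) auto
    then show "?g j j \<in> I" by (simp add: opF_opE_same algebra_simps)
  next
    fix j l :: nat assume jl: "1 \<le> j" "j < l" "l \<le> n"
    have "(X i j * X k l - X k l * X i j - (q - qi) * (X i l * X k j)) * opE n l (opF n j v) s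
        - (X k j * X i l - X i l * X k j) * opE n j (opF n l v) s \<in> I"
      using assms jl by (intro ideal_diff ideal_rmul[OF rel_diag] ideal_rmul[OF rel_anti])
    then show "?g j l + ?g l j \<in> I"
      by (simp add: opF_opE_less[OF jl(2)] opF_opE_greater[OF jl(2)] algebra_simps)
  qed
  then show "eta i (omega k v) s - (omega k (eta i v) s + (q - qi) * omega i (eta k v) s) \<in> I"
    by (simp add: eta_omega omega_eta sum_subtractf sum.distrib sum_distrib_left)
qed


section \<open>Moving a row operator through the whole product\<close>

lemma vcong_add: "v \<approx> v' \<Longrightarrow> w \<approx> w' \<Longrightarrow> (\<lambda>s. v s + w s) \<approx> (\<lambda>s. v' s + w' s)"
  using ideal_add unfolding vcong_def by (metis add_diff_add)

lemma foldr_omega_cong: "v \<approx> w \<Longrightarrow> foldr omega rs v \<approx> foldr omega rs w"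
  by (induction rs) (auto intro: omega_cong)

lemma foldr_omega_scale: "foldr omega rs (\<lambda>s. q * v s) = (\<lambda>s. q * foldr omega rs v s)"
  by (induction rs) (simp_all add: omega_scale)

lemma eta_foldr_omega_less:
  assumes "k \<le> m" "\<And>i. i \<in> set rs \<Longrightarrow> 1 \<le> i \<and> i < k"
  shows "eta k (foldr omega rs v) \<approx> foldr omega rs (eta k v)"
  using assms(2)
proof (induction rs)
  case (Cons r rs)
  have "eta k (omega r (foldr omega rs v)) \<approx> omega r (eta k (foldr omega rs v))"
    using Cons.prems assms(1) by (intro eta_omega_greater) auto
  also have "\<dots> \<approx> omega r (foldr omega rs (eta k v))"
    using Cons by (intro omega_cong) auto
  finally show ?case by simp
qed simp

text \<open>Passing \<open>eta k\<close> through \<open>omega r\<close> leaves a correction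
  \<open>(q - qi)\<close> times \<open>omega k (eta r u)\<close>. The extra \<open>omega k\<close>
  in front kills it, since the square of \<open>omega k\<close> vanishes modulo
  \<open>I\<close>.\<close>

lemma omega_eta_foldr_omega_greater:
  assumes "1 \<le> k" "\<And>i. i \<in> set rs \<Longrightarrow> k < i \<and> i \<le> m"
  shows "omega k (eta k (foldr omega rs v)) \<approx> omega k (foldr omega rs (eta k v))"
  using assms(2)
proof (induction rs)
  case (Cons r rs)
  let ?u = "foldr omega rs v"
  have r: "k < r" "r \<le> m" using Cons.prems by auto
  have IH: "omega k (eta k ?u) \<approx> omega k (foldr omega rs (eta k v))" using Cons by auto
  have "omega k (eta k (omega r ?u))
      \<approx> omega k (\<lambda>s. omega r (eta k ?u) s + (q - qi) * omega k (eta r ?u) s)"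
    using assms(1) r by (intro omega_cong eta_omega_less)
  also have "omega k (\<lambda>s. omega r (eta k ?u) s + (q - qi) * omega k (eta r ?u) s)
      = (\<lambda>s. omega k (omega r (eta k ?u)) s + (q - qi) * omega k (omega k (eta r ?u)) s)"
    by (simp only: omega_add omega_scale_diff)
  also have "\<dots> \<approx> (\<lambda>s. omega k (omega r (eta k ?u)) s + (q - qi) * 0)"
    using assms(1) r by (intro vcong_add vcong_scale omega_same) auto
  also have "(\<lambda>s. omega k (omega r (eta k ?u)) s + (q - qi) * 0) = omega k (omega r (eta k ?u))"
    by simp
  \<comment> \<open>\<open>omega k\<close> is exchanged with \<open>omega r\<close> to stand next to
    \<open>eta k\<close>, where the induction hypothesis applies, and is then exchanged
    back.\<close>
  also have "\<dots> \<approx> (\<lambda>s. - (qi * omega r (omega k (eta k ?u)) s))"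
    using assms(1) r by (intro omega_swap)
  also have "\<dots> \<approx> (\<lambda>s. - (qi * omega r (omega k (foldr omega rs (eta k v))) s))"
    using vcong_scale[OF omega_cong[OF IH, of r], of "- qi"] by simp
  also have "\<dots> \<approx> omega k (omega r (foldr omega rs (eta k v)))"
    using assms(1) r by (intro vcong_sym[OF omega_swap])
  finally show ?case by simp
qed simp

text \<open>The product contains \<open>omega k\<close> exactly once. Smaller rows commute with
  \<open>eta k\<close>, row \<open>k\<close> gives the factor \<open>q\<close>, and for larger rows
  that same \<open>omega k\<close> absorbs the corrections.\<close>

lemma eta_Omega:
  assumes "1 \<le> k" "k \<le> m"
  shows "eta k (foldr omega [1..<Suc m] v) \<approx> (\<lambda>s. q * foldr omega [1..<Suc m] (eta k v) s)"
proof -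
  have split: "[1..<Suc m] = [1..<k] @ k # [Suc k..<Suc m]"
    using assms upt_add_eq_append[of 1 k "Suc m - k"] upt_conv_Cons[of k "Suc m"]
    by (simp del: upt_Suc)
  let ?R = "[Suc k..<Suc m]"
  have "eta k (foldr omega [1..<Suc m] v) \<approx> foldr omega [1..<k] (eta k (omega k (foldr omega ?R v)))"
    using assms eta_foldr_omega_less[of k "[1..<k]" "omega k (foldr omega ?R v)"]
    unfolding split by simp
  also have "\<dots> \<approx> foldr omega [1..<k] (\<lambda>s. q * omega k (eta k (foldr omega ?R v)) s)"
    using assms by (intro foldr_omega_cong eta_omega_same)
  also have "\<dots> \<approx> foldr omega [1..<k] (\<lambda>s. q * omega k (foldr omega ?R (eta k v)) s)"
    using assms by (intro foldr_omega_cong vcong_scale omega_eta_foldr_omega_greater) auto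
  also have "\<dots> = (\<lambda>s. q * foldr omega [1..<Suc m] (eta k v) s)"
    unfolding split by (simp add: foldr_omega_scale)
  finally show ?thesis .
qed

lemma foldr_eta_Omega:
  assumes "\<And>k. k \<in> set ks \<Longrightarrow> 1 \<le> k \<and> k \<le> m"
  shows "foldr eta ks (foldr omega [1..<Suc m] v)
       \<approx> (\<lambda>s. q ^ length ks * foldr omega [1..<Suc m] (foldr eta ks v) s)"
  using assms
proof (induction ks)
  case (Cons k ks)
  let ?O = "foldr omega [1..<Suc m]" and ?l = "length ks"
  have sc: "eta k (\<lambda>s. q ^ p * w s) = (\<lambda>s. q ^ p * eta k w s)" for p w
    by (induction p) (simp_all add: eta_scale mult.assoc)
  have "eta k (foldr eta ks (?O v)) \<approx> eta k (\<lambda>s. q ^ ?l * ?O (foldr eta ks v) s)"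
    using Cons by (intro eta_cong) auto
  also have "\<dots> = (\<lambda>s. q ^ ?l * eta k (?O (foldr eta ks v)) s)" by (rule sc)
  also have "\<dots> \<approx> (\<lambda>s. q ^ ?l * (q * ?O (eta k (foldr eta ks v)) s))"
    using Cons.prems by (intro vcong_scale eta_Omega) auto
  also have "\<dots> = (\<lambda>s. q ^ length (k # ks) * ?O (foldr eta (k # ks) v) s)"
    by (simp add: power_commutes mult.assoc[symmetric] del: upt_Suc)
  finally show ?case by simp
qed simp

section \<open>Comparing coefficients at a basis state\<close>

abbreviation "sl \<equiv> sorted_list_of_set"

text \<open>Words in \<open>f\<close> applied to the vacuum create no \<open>e\<close>, so among all
  pairs of index sets only \<open>J\<close>, \<open>K\<close> itself reaches the state of
  \<open>J\<close>, \<open>K\<close>, and its coefficient is a power of \<open>- qi\<close>.\<close>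

lemma Omega_eta_coefficient:
  assumes J: "J \<in> Pi_mn m n" and K: "K \<in> Pi_mn m n"
  obtains k where "foldr omega [1..<Suc m] (foldr eta [1..<Suc m] (vacuum n)) (fock_state n J K)
     = (- qi) ^ k * (minor X m J * minor X m K)"
proof -
  let ?s = "fock_state n J K"
  let ?c = "\<lambda>J' K'. foldr (opE n) (sl J') (foldr (opF n) (sl K') (vacuum n)) ?s"
  note fin = finite_of_Pi_mn
  have sub: "J \<subseteq> {1..n}" "K \<subseteq> {1..n}" using J K by (auto simp: Pi_mn_def)
  have zero: "?c J' K' = 0" if J': "J' \<in> Pi_mn m n" and K': "K' \<in> Pi_mn m n" and ne: "J' \<noteq> J \<or> K' \<noteq> K" for J' K'
  proof (rule ccontr)
    assume "?c J' K' \<noteq> 0"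
    from foldr_opE_support[OF this] obtain s' where s': "foldr (opF n) (sl K') (vacuum n) s' \<noteq> 0"
      "occE n ?s = J' \<union> occE n s'" "occF n ?s = occF n s'" using fin[OF J'] by auto
    from foldr_opF_support[OF _ s'(1)] obtain s'' where "vacuum n s'' \<noteq> 0" "occE n s' = {}"
      "occF n s' = K' \<union> occF n s''" using vacuum_support fin[OF K'] by auto
    then have "occE n ?s = J'" "occF n ?s = K'" using s' vacuum_support[of n s''] by auto
    then show False using ne sub by (auto simp: occE_fock_state occF_fock_state)
  qed
  obtain k1 where k1: "\<And>v. foldr (opE n) (sl J) v ?s = (- qi) ^ k1 * v (fock_state n (J - J) K)"
    using foldr_opE_fock_state[of "sl J" J n K] sub fin[OF J] by auto
  obtain k2 where k2: "\<And>v. foldr (opF n) (sl K) v (fock_state n {} K)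
      = (- qi) ^ k2 * v (fock_state n {} (K - K))"
    using foldr_opF_fock_state[of "sl K" K n] sub fin[OF K] by auto
  have c: "?c J K = (- qi) ^ (k1 + k2)"
    by (simp add: k1 k2 vacuum_def power_add)
  have comm: "y * (- qi) ^ k = (- qi) ^ k * y" for k y
    using power_commuting_commutes[of "- qi" y k] by (simp add: qi_central[of y])
  have "foldr omega [1..<Suc m] (foldr eta [1..<Suc m] (vacuum n)) ?s
      = (\<Sum>J'\<in>Pi_mn m n. \<Sum>K'\<in>Pi_mn m n. minor X m J' * (minor X m K' * ?c J' K'))"
    unfolding omega_def eta_def foldr_row_op[OF qexterior_opE] foldr_row_op[OF qexterior_opF]
    by (simp add: foldr_op_sum[OF qexterior_opE] foldr_op_scale[OF qexterior_opE] sum_distrib_left)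
  also have "\<dots> = (\<Sum>J'\<in>Pi_mn m n. \<Sum>K'\<in>Pi_mn m n.
      if K' = K then if J' = J then minor X m J * (minor X m K * ?c J K) else 0 else 0)"
    by (intro sum.cong refl) (simp add: zero J K)
  also have "\<dots> = minor X m J * (minor X m K * ?c J K)"
    using finite_Pi_mn J K by (simp add: sum.delta)
  also have "\<dots> = (- qi) ^ (k1 + k2) * (minor X m J * minor X m K)"
    unfolding c by (metis comm mult.assoc)
  finally show ?thesis by (rule that)
qed

lemma eta_Omega_expansion:
  "foldr eta [1..<Suc m] (foldr omega [1..<Suc m] v) s
   = (\<Sum>K\<in>Pi_mn m n. \<Sum>J\<in>Pi_mn m n.
        minor X m K * (minor X m J * foldr (opF n) (sl K) (foldr (opE n) (sl J) v) s))"
  unfolding omega_def eta_def foldr_row_op[OF qexterior_opE] foldr_row_op[OF qexterior_opF]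
  by (simp add: foldr_op_sum[OF qexterior_opF] foldr_op_scale[OF qexterior_opF] sum_distrib_left)

text \<open>Whatever the \<open>e\<close> have created, every letter of the \<open>f\<close> word
  adds a new index at least as large, so no more elements of \<open>K\<close> than of
  \<open>K'\<close> reach a given threshold.\<close>

lemma commutation_coefficient_st_le:
  assumes "K \<in> Pi_mn m n" "K' \<in> Pi_mn m n" "J \<in> Pi_mn m n"
    and nz: "foldr (opF n) (sl K) (foldr (opE n) (sl J) (vacuum n)) (fock_state n J' K') \<noteq> 0"
  shows "st_le m K K'"
proof (rule st_leI_card[OF assms(1,2)])
  fix t
  have fin: "finite K" "K' \<subseteq> {1..n}"
    using assms(2) finite_of_Pi_mn[OF assms(1)] by (auto simp: Pi_mn_def)
  have "{k \<in> K. t \<le> k} = set (filter ((\<le>) t) (sl K))" using fin by auto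
  then have "card {k \<in> K. t \<le> k} = length (filter ((\<le>) t) (sl K))"
    by (simp only:) (rule distinct_card, simp)
  also have "\<dots> \<le> card {k \<in> occF n (fock_state n J' K'). t \<le> k}"
    using foldr_opF_count[OF nz, of t] by (meson add_leD1)
  also have "occF n (fock_state n J' K') = K'" using fin by (auto simp: occF_fock_state)
  finally show "card {k \<in> K. t \<le> k} \<le> card {k \<in> K'. t \<le> k}" .
qed

text \<open>Both sides of \<open>foldr_eta_Omega\<close>, applied to the vacuum, are compared at the
  state of \<open>J\<close>, \<open>K\<close>. The second claim expresses that \<open>c\<close> is a
  scalar, in a ring without a distinguished ground field: \<open>c\<close> is built from
  \<open>1\<close> by addition, negation, \<open>q\<close> and \<open>qi\<close>.\<close>

lemma minor_commutation:
  assumes J: "J \<in> Pi_mn m n" and K: "K \<in> Pi_mn m n"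
  obtains c where
    "minor X m J * minor X m K -
     (\<Sum>K'\<in>{K' \<in> Pi_mn m n. st_le m K' K}. \<Sum>J'\<in>Pi_mn m n.
        minor X m K' * (minor X m J' * c K' J')) \<in> I"
    "\<And>M K' J'. scalar_stable M \<Longrightarrow> 1 \<in> M \<Longrightarrow> c K' J' \<in> M"
proof -
  let ?s = "fock_state n J K"
  define c where "c = (\<lambda>K' J'. foldr (opF n) (sl K') (foldr (opE n) (sl J') (vacuum n)) ?s)"
  obtain k where k: "foldr omega [1..<Suc m] (foldr eta [1..<Suc m] (vacuum n)) ?s
     = (- qi) ^ k * (minor X m J * minor X m K)"
    using Omega_eta_coefficient[OF J K] .
  \<comment> \<open>The central inverse of the unit \<open>q ^ m * (- qi) ^ k\<close> in front of
    the product of minors.\<close>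
  let ?d = "(- q) ^ k * qi ^ m"
  have comm: "y * ?d = ?d * y" for y
  proof -
    have "y * (- q) ^ k = (- q) ^ k * y" for y
      using power_commuting_commutes[of "- q" y k] by (simp add: q_central[of y])
    moreover have "y * qi ^ m = qi ^ m * y" for y
      using power_commuting_commutes[of qi y m] by (simp add: qi_central[of y])
    ultimately show ?thesis by (metis mult.assoc)
  qed
  have inv: "?d * (q ^ m * (- qi) ^ k) = 1"
  proof -
    have "qi ^ m * q ^ m = 1" "(- q) ^ k * (- qi) ^ k = 1"
      by (intro left_right_inverse_power; simp)+
    then show ?thesis by (metis mult.assoc mult_1_left)
  qed
  let ?T = "\<Sum>K'\<in>Pi_mn m n. \<Sum>J'\<in>Pi_mn m n. minor X m K' * (minor X m J' * c K' J')"
  have "?T - q ^ m * ((- qi) ^ k * (minor X m J * minor X m K)) \<in> I"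
    using foldr_eta_Omega[of "[1..<Suc m]" "vacuum n", unfolded vcong_def, THEN spec, of ?s]
    unfolding k eta_Omega_expansion c_def by (simp del: upt_Suc)
  from ideal_lmul[OF this, of ?d]
  have "?d * ?T - minor X m J * minor X m K \<in> I"
    using inv by (simp add: right_diff_distrib flip: mult.assoc)
  moreover have "?T = (\<Sum>K'\<in>{K' \<in> Pi_mn m n. st_le m K' K}. \<Sum>J'\<in>Pi_mn m n.
      minor X m K' * (minor X m J' * c K' J'))"
  proof (rule sum.mono_neutral_right[OF finite_Pi_mn])
    show "\<forall>K'\<in>Pi_mn m n - {K' \<in> Pi_mn m n. st_le m K' K}.
       (\<Sum>J'\<in>Pi_mn m n. minor X m K' * (minor X m J' * c K' J')) = 0"
    proof
      fix K' assume K': "K' \<in> Pi_mn m n - {K' \<in> Pi_mn m n. st_le m K' K}"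
      have "c K' J' = 0" if "J' \<in> Pi_mn m n" for J'
        using commutation_coefficient_st_le[of K' K J' J] K' that K by (auto simp: c_def)
      then show "(\<Sum>J'\<in>Pi_mn m n. minor X m K' * (minor X m J' * c K' J')) = 0" by simp
    qed
  qed auto
  \<comment> \<open>Being central, \<open>?d\<close> can be absorbed into the coefficient
    \<open>c\<close>.\<close>
  moreover have "?d * (x * (y * z)) = x * (y * (?d * z))" for x y z
    by (metis comm mult.assoc)
  ultimately have "(\<Sum>K'\<in>{K' \<in> Pi_mn m n. st_le m K' K}. \<Sum>J'\<in>Pi_mn m n.
        minor X m K' * (minor X m J' * (?d * c K' J'))) - minor X m J * minor X m K \<in> I"
    by (simp only: sum_distrib_left)
  note diff = ideal_uminus[OF this, unfolded minus_diff_eq]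
  show ?thesis
  proof (rule that[OF diff])
    fix M :: "'a set" and K' J'
    assume M: "scalar_stable M" "1 \<in> M"
    note D = scalar_stableD[OF M(1)]
    have "foldr (opE n) w (vacuum n) s \<in> M" for w s
      by (induction w arbitrary: s) (auto simp: vacuum_def M D intro!: opE_closed[OF M(1)])
    then have "foldr (opF n) w (foldr (opE n) w' (vacuum n)) s \<in> M" for w w' s
      by (induction w arbitrary: s) (auto intro!: opF_closed[OF M(1)])
    then have "c K' J' \<in> M" by (simp add: c_def)
    then have "qi ^ p * c K' J' \<in> M" for p by (induction p) (auto simp: mult.assoc D)
    then have "(- q) ^ k * (qi ^ p * c K' J') \<in> M" for p
      by (induction k) (auto simp: mult.assoc D)
    then show "?d * c K' J' \<in> M" by (simp add: mult.assoc)
  qed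
qed

end

section \<open>Noncommutative polynomials\<close>

text \<open>With concatenation as addition of exponents, the convolution product of
  \<open>poly_mapping\<close> is that of the free algebra, and \<open>ncpoly\<close> becomes a
  ring.\<close>

instantiation list :: (type) monoid_add
begin
definition "0 = []"
definition "xs + ys = xs @ ys"
instance by standard (simp_all add: zero_list_def plus_list_def)
end

lemma sum_single: "p = (\<Sum>u\<in>Poly_Mapping.keys p. Poly_Mapping.single u (Poly_Mapping.lookup p u))"
  by (rule poly_mapping_eqI)
     (simp add: lookup_sum lookup_single when_def in_keys_iff)

lemma ncmul_eq_times: "ncmul p r = p * r"
proof -
  have "p * r = (\<Sum>u\<in>Poly_Mapping.keys p. Poly_Mapping.single u (Poly_Mapping.lookup p u))
      * (\<Sum>v\<in>Poly_Mapping.keys r. Poly_Mapping.single v (Poly_Mapping.lookup r v))"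
    by (simp flip: sum_single)
  then show ?thesis
    by (simp add: ncmul_def sum_product mult_single plus_list_def)
qed

lemma ncconst_commute: "p * ncconst c = ncconst c * p"
proof -
  have "(\<Sum>u\<in>Poly_Mapping.keys p. Poly_Mapping.single u (Poly_Mapping.lookup p u)) * ncconst c
      = ncconst c * (\<Sum>u\<in>Poly_Mapping.keys p. Poly_Mapping.single u (Poly_Mapping.lookup p u))"
    by (simp add: ncconst_def sum_distrib_left sum_distrib_right mult_single plus_list_def mult.commute)
  then show ?thesis by (simp flip: sum_single)
qed

lemma ncconst_1 [simp]: "ncconst 1 = 1" and ncconst_0 [simp]: "ncconst 0 = 0"
  by (simp_all add: ncconst_def flip: zero_list_def)

lemma ncconst_mult: "ncconst c * ncconst d = ncconst (c * d)"
  by (simp add: ncconst_def mult_single plus_list_def)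

lemma ncconst_add: "ncconst c + ncconst d = ncconst (c + d)"
  by (simp add: ncconst_def single_add)

lemma ncconst_uminus: "- ncconst c = ncconst (- c)"
  by (simp add: ncconst_def single_uminus)

lemma ncconst_power: "ncconst c ^ k = ncconst (c ^ k)"
  by (induction k) (simp_all add: ncconst_mult)

lemma quantum_scalars_ncconst:
  assumes "q \<noteq> 0"
  shows "quantum_scalars (ncconst q) (ncconst (inverse q))"
proof
  show "ncconst q * ncconst (inverse q) = 1" "ncconst (inverse q) * ncconst q = 1"
    using assms by (simp_all add: ncconst_mult)
qed (rule ncconst_commute)+

lemma quantum_matrices_ncX:
  assumes "q \<noteq> 0"
  shows "quantum_matrices (ncconst q) (ncconst (inverse q)) ncX m n (qmat_ideal m n q)"
proof (rule quantum_matrices.intro[OF quantum_scalars_ncconst[OF assms]], unfold_locales)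
  let ?I = "qmat_ideal m n q"
  show "0 \<in> ?I" by (rule qmat_ideal.zero)
  show "x + y \<in> ?I" if "x \<in> ?I" "y \<in> ?I" for x y using that by (rule qmat_ideal.add)
  show "a * x \<in> ?I" if "x \<in> ?I" for a x using qmat_ideal.lmul[OF that] by (simp add: ncmul_eq_times)
  show "x * a \<in> ?I" if "x \<in> ?I" for a x using qmat_ideal.rmul[OF that] by (simp add: ncmul_eq_times)
  fix i j l k :: nat
  show "ncX i j * ncX i l - ncconst q * (ncX i l * ncX i j) \<in> ?I"
    if "1 \<le> i" "i \<le> m" "1 \<le> j" "j < l" "l \<le> n"
    unfolding ncmul_eq_times[symmetric]
    by (rule qmat_ideal.rel) (use that in \<open>unfold qmat_rels_def, blast\<close>)
  show "ncX i j * ncX k j - ncconst q * (ncX k j * ncX i j) \<in> ?I"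
    if "1 \<le> i" "i < k" "k \<le> m" "1 \<le> j" "j \<le> n"
    unfolding ncmul_eq_times[symmetric]
    by (rule qmat_ideal.rel) (use that in \<open>unfold qmat_rels_def, blast\<close>)
  show "ncX k j * ncX i l - ncX i l * ncX k j \<in> ?I"
    if "1 \<le> i" "i < k" "k \<le> m" "1 \<le> j" "j < l" "l \<le> n"
    unfolding ncmul_eq_times[symmetric]
    by (rule qmat_ideal.rel) (use that in \<open>unfold qmat_rels_def, blast\<close>)
  have eq: "ncconst q - ncconst (inverse q) = ncconst (q - inverse q)"
    by (simp add: ncconst_def single_diff)
  show "ncX i j * ncX k l - ncX k l * ncX i j
      - (ncconst q - ncconst (inverse q)) * (ncX i l * ncX k j) \<in> ?I"
    if "1 \<le> i" "i < k" "k \<le> m" "1 \<le> j" "j < l" "l \<le> n"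
    unfolding ncmul_eq_times[symmetric] eq
    by (rule qmat_ideal.rel) (use that in \<open>unfold qmat_rels_def, blast\<close>)
qed

section \<open>Identification with the minors given by permutations\<close>

lemma inversions_conv_card:
  "distinct xs \<Longrightarrow> inversions xs = card {(a, b). a < b \<and> b < length xs \<and> xs ! b < xs ! a}"
proof (induction xs)
  case (Cons x xs)
  let ?P = "{(a, b). a < b \<and> b < length xs \<and> xs ! b < xs ! a}"
  let ?B = "{b. b < length xs \<and> xs ! b < x}"
  have fin: "finite ?P" by (rule finite_subset[of _ "{..<length xs} \<times> {..<length xs}"]) auto
  \<comment> \<open>An inverted pair either starts at position 0 or is the shift of an inverted pair
    of the tail.\<close>
  have "{(a, b). a < b \<and> b < length (x # xs) \<and> (x # xs) ! b < (x # xs) ! a}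
      = (\<lambda>b. (0, Suc b)) ` ?B \<union> map_prod Suc Suc ` ?P" (is "?L = ?R")
  proof
    show "?L \<subseteq> ?R"
    proof safe
      fix a b assume *: "a < b" "b < length (x # xs)" "(x # xs) ! b < (x # xs) ! a"
        "(a, b) \<notin> map_prod Suc Suc ` ?P"
      obtain b' where b: "b = Suc b'" using *(1) by (cases b) auto
      show "(a, b) \<in> (\<lambda>b. (0, Suc b)) ` ?B"
      proof (cases a)
        case 0 then show ?thesis using *(1-3) b by auto
      next
        case (Suc a')
        then have "(a', b') \<in> ?P" using *(1-3) b by auto
        then have "map_prod Suc Suc (a', b') \<in> map_prod Suc Suc ` ?P" by (rule imageI)
        then show ?thesis using *(4) b Suc by simp
      qed
    qed
  qed auto
  moreover have "card ((\<lambda>b. (0::nat, Suc b)) ` ?B) = card ?B"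
    by (rule card_image) (auto simp: inj_on_def)
  moreover have "card (map_prod Suc Suc ` ?P) = card ?P"
    by (rule card_image) (auto simp: inj_on_def)
  moreover have "(\<lambda>b. (0, Suc b)) ` ?B \<inter> map_prod Suc Suc ` ?P = {}" by auto
  moreover have "card {y \<in> set xs. y < x} = card ?B"
    using Cons.prems distinct_card[of "filter (\<lambda>y. y < x) xs"] by (simp add: length_filter_conv_card)
  ultimately show ?case using Cons fin by (simp add: card_Un_disjoint)
qed simp

lemma jth_less_iff:
  assumes "finite J" "card J = m" "a \<in> {1..m}" "b \<in> {1..m}"
  shows "jth J a < jth J b \<longleftrightarrow> a < b"
proof -
  have mono: "jth J a < jth J b" if "a < b" "a \<in> {1..m}" "b \<in> {1..m}" for a b
  proof -
    have "a - 1 < b - 1" "b - 1 < length (sorted_list_of_set J)" using that assms by auto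
    then show ?thesis unfolding jth_def
      using sorted_wrt_nth_less[OF strict_sorted_list_of_set] by blast
  qed
  show ?thesis using mono[of a b] mono[of b a] assms by (cases a b rule: linorder_cases) auto
qed

lemma jth_image:
  assumes "finite J" "card J = m"
  shows "jth J ` {1..m} = J"
proof -
  have "jth J ` {1..m} = (!) (sorted_list_of_set J) ` {..<m}"
    unfolding jth_def image_Suc_lessThan[symmetric] image_image by simp
  also have "\<dots> = set (sorted_list_of_set J)"
    using assms by (auto simp: set_conv_nth)
  finally show ?thesis using assms by simp
qed

text \<open>A permutation corresponds to the word with letters \<open>jth J (\<sigma> s)\<close>;
  since \<open>jth J\<close> is increasing, the inversions of the word are those of the
  permutation.\<close>

lemma qminor_eq_minor:
  assumes q: "q \<noteq> 0" and J: "J \<in> Pi_mn m n"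
  shows "qminor m q J = quantum_scalars.minor (ncconst q) ncX m J"
proof -
  let ?w = "\<lambda>\<sigma>. map (\<lambda>s. jth J (\<sigma> s)) [1..<Suc m]"
  let ?S = "{\<sigma>. \<sigma> permutes {1..m}}"
  have fin: "finite J" and card: "card J = m" using finite_of_Pi_mn[OF J] J by (auto simp: Pi_mn_def)
  note less = jth_less_iff[OF fin card]
  have inj: "inj_on (jth J) {1..m}"
  proof (rule inj_onI)
    fix a b assume "a \<in> {1..m}" "b \<in> {1..m}" "jth J a = jth J b"
    then show "a = b" using less[of a b] less[of b a] by (cases a b rule: linorder_cases) auto
  qed
  have "inj_on ?w ?S"
  proof (rule inj_onI)
    fix \<sigma> \<tau> assume \<sigma>: "\<sigma> \<in> ?S" and \<tau>: "\<tau> \<in> ?S" and eq: "?w \<sigma> = ?w \<tau>"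
    show "\<sigma> = \<tau>"
    proof
      fix s
      show "\<sigma> s = \<tau> s"
      proof (cases "s \<in> {1..m}")
        case True
        then have "jth J (\<sigma> s) = jth J (\<tau> s)" using eq by (simp del: upt_Suc)
        moreover have "\<sigma> s \<in> {1..m}" "\<tau> s \<in> {1..m}"
          using \<sigma> \<tau> True permutes_in_image[of \<sigma> "{1..m}" s] permutes_in_image[of \<tau> "{1..m}" s]
          by simp_all
        ultimately show ?thesis using inj by (auto dest: inj_onD)
      next
        case False
        then show ?thesis using \<sigma> \<tau> by (auto simp: permutes_def)
      qed
    qed
  qed
  moreover have sub: "?w ` ?S \<subseteq> permutations_of_set J"
  proof safe
    fix \<sigma> assume \<sigma>: "\<sigma> permutes {1..m}"
    have im: "\<sigma> ` {1..m} = {1..m}" using \<sigma> by (rule permutes_image)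
    have set: "set [1..<Suc m] = {1..m}" by auto
    have "set (?w \<sigma>) = J"
      unfolding set_map set using jth_image[OF fin card] im by (metis image_image)
    moreover have "inj_on (jth J \<circ> \<sigma>) {1..m}"
      by (rule comp_inj_on) (simp_all only: im inj permutes_inj_on[OF \<sigma>])
    then have "distinct (?w \<sigma>)"
      unfolding distinct_map set by (simp add: comp_def del: upt_Suc)
    ultimately show "?w \<sigma> \<in> permutations_of_set J" by (simp add: permutations_of_set_def)
  qed
  \<comment> \<open>Surjectivity follows by counting: both sets have \<open>m!\<close>
    elements.\<close>
  ultimately have bij: "bij_betw ?w ?S (permutations_of_set J)"
    using card_subset_eq[OF finite_permutations_of_set sub] fin card card_permutations[of "{1..m}" m]
    by (simp add: bij_betw_def card_image)
  have inv: "inversions (?w \<sigma>) = perm_length m \<sigma>" if "\<sigma> \<in> ?S" for \<sigma>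
  proof -
    have "distinct (?w \<sigma>)" using sub that by (auto simp: permutations_of_set_def)
    then have "inversions (?w \<sigma>) = card {(a, b). a < b \<and> b < m \<and> ?w \<sigma> ! b < ?w \<sigma> ! a}"
      by (subst inversions_conv_card) (simp_all del: upt_Suc)
    also have "{(a, b). a < b \<and> b < m \<and> ?w \<sigma> ! b < ?w \<sigma> ! a}
        = {(a, b). a < b \<and> b < m \<and> \<sigma> (Suc b) < \<sigma> (Suc a)}"
    proof -
      have "\<sigma> (Suc a) \<in> {1..m}" if "a < m" for a
        using \<open>\<sigma> \<in> ?S\<close> that permutes_in_image[of \<sigma> "{1..m}" "Suc a"] by auto
      then show ?thesis using less by (auto simp del: upt_Suc)
    qed
    \<comment> \<open>Positions in the word count from 0, rows from 1.\<close>
    also have "card \<dots> = card (map_prod Suc Suc ` \<dots>)"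
      by (rule card_image[symmetric]) (auto simp: inj_on_def)
    also have "map_prod Suc Suc ` {(a, b). a < b \<and> b < m \<and> \<sigma> (Suc b) < \<sigma> (Suc a)}
        = {(a, b). a \<in> {1..m} \<and> b \<in> {1..m} \<and> a < b \<and> \<sigma> b < \<sigma> a}"
    proof safe
      fix a b assume *: "a \<in> {1..m}" "b \<in> {1..m}" "a < b" "\<sigma> b < \<sigma> a"
      then show "(a, b) \<in> map_prod Suc Suc ` {(a, b). a < b \<and> b < m \<and> \<sigma> (Suc b) < \<sigma> (Suc a)}"
        by (intro image_eqI[of _ _ "(a - 1, b - 1)"]) auto
    qed auto
    finally show ?thesis by (simp add: perm_length_def)
  qed
  have word: "prod_list (map2 ncX rs w) = Poly_Mapping.single (zip rs w) 1" for rs w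
  proof (induction rs arbitrary: w)
    case (Cons r rs)
    then show ?case
      by (cases w) (simp_all add: ncX_def mult_single plus_list_def ncconst_1[unfolded ncconst_def])
  qed (simp add: ncconst_1[unfolded ncconst_def])
  have zip: "zip [1..<Suc m] (?w \<sigma>) = map (\<lambda>s. (s, jth J (\<sigma> s))) [1..<m + 1]" for \<sigma>
    by (simp add: zip_map2 zip_same_conv_map del: upt_Suc)
  have "quantum_scalars.minor (ncconst q) ncX m J
     = (\<Sum>w\<in>permutations_of_set J. Poly_Mapping.single (zip [1..<Suc m] w) ((- q) ^ inversions w))"
    unfolding quantum_scalars.minor_def[OF quantum_scalars_ncconst[OF q]] word ncconst_uminus ncconst_power
    by (simp add: ncconst_def mult_single plus_list_def del: upt_Suc)
  also have "\<dots> = (\<Sum>\<sigma>\<in>?S. Poly_Mapping.single (zip [1..<Suc m] (?w \<sigma>)) ((- q) ^ inversions (?w \<sigma>)))"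
    by (rule sum.reindex_bij_betw[OF bij, symmetric])
  also have "\<dots> = qminor m q J"
    unfolding qminor_def zip using inv by (intro sum.cong) simp_all
  finally show ?thesis by simp
qed

section \<open>Left multiplication on the right ideal\<close>

lemma right_gen_sum: "(\<And>i. i \<in> N \<Longrightarrow> f i \<in> right_gen A S) \<Longrightarrow> sum f N \<in> right_gen A S"
  by (induction N rule: infinite_finite_induct) (auto intro: right_gen.zero right_gen.add)

lemma right_gen_times:
  assumes "\<And>a b. a \<in> A \<Longrightarrow> b \<in> A \<Longrightarrow> a * b \<in> A" "a \<in> A"
  shows "x \<in> right_gen A S \<Longrightarrow> x * a \<in> right_gen A S"
proof (induction rule: right_gen.induct)
  case (gen s b)
  have "ncmul s (b * a) \<in> right_gen A S" using gen assms by (intro right_gen.gen)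
  then show ?case by (simp add: ncmul_eq_times mult.assoc)
qed (auto simp: distrib_right intro: right_gen.zero right_gen.add)

text \<open>The commutation relation puts minors with \<open>K' \<le> K\<close> in front, and the
  index sets not above \<open>\<gamma>\<close> are closed downwards, so each summand is a generator
  times an element of the subalgebra.\<close>

lemma qminor_times_qminor_in_right_gen:
  assumes q: "q \<noteq> 0" and J: "J \<in> Pi_mn m n" and K: "K \<in> Pi_mn m n" "\<not> st_le m \<gamma> K"
  shows "\<exists>y\<in>right_gen (qgrass_lift m n q) (qminor m q ` {\<pi> \<in> Pi_mn m n. \<not> st_le m \<gamma> \<pi>}).
           qminor m q J * qminor m q K - y \<in> qmat_ideal m n q"
proof -
  interpret quantum_matrices "ncconst q" "ncconst (inverse q)" ncX m n "qmat_ideal m n q"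
    by (rule quantum_matrices_ncX[OF q])
  let ?A = "qgrass_lift m n q" and ?S = "qminor m q ` {\<pi> \<in> Pi_mn m n. \<not> st_le m \<gamma> \<pi>}"
  obtain c where c: "minor ncX m J * minor ncX m K -
     (\<Sum>K'\<in>{K' \<in> Pi_mn m n. st_le m K' K}. \<Sum>J'\<in>Pi_mn m n.
        minor ncX m K' * (minor ncX m J' * c K' J')) \<in> qmat_ideal m n q"
    and cM: "\<And>M K' J'. scalar_stable M \<Longrightarrow> 1 \<in> M \<Longrightarrow> c K' J' \<in> M"
    by (rule minor_commutation[OF J K(1)]) blast
  \<comment> \<open>The constants form a stable set containing \<open>1\<close>, so every
    \<open>c K' J'\<close> is a constant and lies in the subalgebra.\<close>
  have "scalar_stable (range ncconst)"
    unfolding scalar_stable_def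
    by (auto simp: ncconst_mult ncconst_add ncconst_uminus intro: range_eqI[of _ _ 0])
  then have "c K' J' \<in> range ncconst" for K' J'
    by (rule cM) (auto intro: range_eqI[of _ _ 1])
  then have cA: "c K' J' \<in> ?A" for K' J'
    unfolding qgrass_lift_def using gen_subalg.const by (metis rangeE)
  let ?y = "\<Sum>K'\<in>{K' \<in> Pi_mn m n. st_le m K' K}. \<Sum>J'\<in>Pi_mn m n.
        qminor m q K' * (qminor m q J' * c K' J')"
  have "?y \<in> right_gen ?A ?S"
  proof (intro right_gen_sum)
    fix K' J' assume K': "K' \<in> {K' \<in> Pi_mn m n. st_le m K' K}" and J': "J' \<in> Pi_mn m n"
    have "\<not> st_le m \<gamma> K'" using K' K st_le_trans by blast
    then have "qminor m q K' \<in> ?S" using K' by blast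
    moreover have "ncmul (qminor m q J') (c K' J') \<in> ?A"
      using cA J' unfolding qgrass_lift_def by (intro gen_subalg.mul[OF gen_subalg.gen]) auto
    ultimately show "qminor m q K' * (qminor m q J' * c K' J') \<in> right_gen ?A ?S"
      using right_gen.gen[of "qminor m q K'" ?S _ ?A] by (simp add: ncmul_eq_times)
  qed
  moreover have "qminor m q J * qminor m q K - ?y \<in> qmat_ideal m n q"
    using c by (simp add: qminor_eq_minor[OF q, where n = n] J K)
  ultimately show ?thesis by blast
qed

theorem theorem3p3p3:
  fixes m n :: nat and q :: complex and \<gamma> :: "nat set"
  assumes "1 \<le> m" and "m \<le> n"
    and "q \<noteq> 0" and "\<forall>k::nat. k > 0 \<longrightarrow> q ^ k \<noteq> 1"
    and "\<gamma> \<in> Pi_mn m n"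
  defines "A \<equiv> qgrass_lift m n q"
    and "S \<equiv> qminor m q ` {\<pi> \<in> Pi_mn m n. \<not> st_le m \<gamma> \<pi>}"
  shows "{x. \<exists>y\<in>twosided_gen A S. qmat_cong m n q x y}
       = {x. \<exists>y\<in>right_gen A S. qmat_cong m n q x y}"
proof -
  interpret quantum_matrices "ncconst q" "ncconst (inverse q)" ncX m n "qmat_ideal m n q"
    by (rule quantum_matrices_ncX[OF \<open>q \<noteq> 0\<close>])
  let ?I = "qmat_ideal m n q"
  have A_mult: "a * b \<in> A" if "a \<in> A" "b \<in> A" for a b
    using gen_subalg.mul that unfolding A_def qgrass_lift_def ncmul_eq_times .
  have A_const: "ncconst c \<in> A" for c
    unfolding A_def qgrass_lift_def by (rule gen_subalg.const)
  \<comment> \<open>The induction follows the construction of \<open>a\<close> and keeps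
    \<open>r\<close> arbitrary: for a product \<open>a * b\<close>, the element representing
    \<open>b * r\<close> modulo the ideal takes the place of \<open>r\<close>.\<close>
  have left: "\<exists>y\<in>right_gen A S. a * r - y \<in> ?I" if "a \<in> A" "r \<in> right_gen A S" for a r
    using that unfolding A_def[unfolded qgrass_lift_def]
  proof (induction a arbitrary: r rule: gen_subalg.induct)
    case (gen g)
    then obtain J where J: "J \<in> Pi_mn m n" "g = qminor m q J" by blast
    from gen(2) show ?case unfolding A_def[unfolded qgrass_lift_def, symmetric]
    proof (induction r rule: right_gen.induct)
      case zero
      show ?case by (intro bexI[of _ 0] right_gen.zero) (simp add: ideal_zero)
    next
      case (gen s b)
      then obtain K where K: "K \<in> Pi_mn m n" "\<not> st_le m \<gamma> K" "s = qminor m q K"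
        by (auto simp: S_def)
      obtain y where y: "y \<in> right_gen A S" "g * s - y \<in> ?I"
        using qminor_times_qminor_in_right_gen[OF \<open>q \<noteq> 0\<close> J(1) K(1,2)] J K
        unfolding A_def S_def by blast
      have "g * ncmul s b - y * b \<in> ?I"
        using ideal_rmul[OF y(2), of b] by (simp add: ncmul_eq_times left_diff_distrib mult.assoc)
      then show ?case using right_gen_times[OF A_mult \<open>b \<in> A\<close> y(1)] by blast
    next
      case (add x y)
      then obtain x' y' where "x' \<in> right_gen A S" "g * x - x' \<in> ?I"
        "y' \<in> right_gen A S" "g * y - y' \<in> ?I" by blast
      moreover from this have "g * (x + y) - (x' + y') \<in> ?I"
        using ideal_add[of "g * x - x'" "g * y - y'"] by (simp add: algebra_simps)
      ultimately show ?case using right_gen.add by blast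
    qed
  next
    case (const c)
    \<comment> \<open>Constants are central, so the left factor becomes a right factor, which the
      right ideal absorbs.\<close>
    have "ncconst c * r = r * ncconst c" by (rule ncconst_commute[symmetric])
    then have "ncconst c * r \<in> right_gen A S"
      using right_gen_times[OF A_mult A_const] const
      unfolding A_def[unfolded qgrass_lift_def, symmetric] by simp
    then show ?case unfolding A_def[unfolded qgrass_lift_def, symmetric]
      by (intro bexI[of _ "ncconst c * r"]) (simp_all add: ideal_zero)
  next
    case (add a b)
    then obtain x y where "x \<in> right_gen A S" "a * r - x \<in> ?I" "y \<in> right_gen A S" "b * r - y \<in> ?I"
      unfolding A_def[unfolded qgrass_lift_def, symmetric] by blast
    moreover from this have "(a + b) * r - (x + y) \<in> ?I"
      using ideal_add[of "a * r - x" "b * r - y"] by (simp add: algebra_simps)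
    ultimately show ?case unfolding A_def[unfolded qgrass_lift_def, symmetric]
      using right_gen.add by blast
  next
    case (mul a b)
    note mul = mul[folded A_def[unfolded qgrass_lift_def]]
    obtain y where y: "y \<in> right_gen A S" "b * r - y \<in> ?I" using mul by blast
    obtain x where x: "x \<in> right_gen A S" "a * y - x \<in> ?I" using mul y by blast
    have "a * (b * r - y) + (a * y - x) \<in> ?I" using ideal_add ideal_lmul x y by blast
    then have "ncmul a b * r - x \<in> ?I" by (simp add: ncmul_eq_times algebra_simps)
    then show ?case using x unfolding A_def[unfolded qgrass_lift_def, symmetric] by blast
  qed
  have two: "\<exists>y\<in>right_gen A S. x - y \<in> ?I" if "x \<in> twosided_gen A S" for x
    using that
  proof (induction rule: twosided_gen.induct)
    case zero
    show ?case by (intro bexI[of _ 0] right_gen.zero) (simp add: ideal_zero)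
  next
    case (gen s a b)
    have "s * b \<in> right_gen A S" using right_gen.gen[OF gen(1,3)] by (simp add: ncmul_eq_times)
    from left[OF gen(2) this] show ?case by (simp add: ncmul_eq_times mult.assoc)
  next
    case (add x y)
    then obtain x' y' where "x' \<in> right_gen A S" "x - x' \<in> ?I" "y' \<in> right_gen A S" "y - y' \<in> ?I"
      by blast
    moreover from this have "x + y - (x' + y') \<in> ?I"
      using ideal_add[of "x - x'" "y - y'"] by (simp add: algebra_simps)
    ultimately show ?case using right_gen.add by blast
  qed
  have "right_gen A S \<subseteq> twosided_gen A S"
  proof
    fix x assume "x \<in> right_gen A S"
    then show "x \<in> twosided_gen A S"
    proof (induction rule: right_gen.induct)
      case (gen s b)
      \<comment> \<open>The left factor is taken to be \<open>1\<close>.\<close>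
      then show ?case using twosided_gen.gen[OF gen(1) A_const[of 1] gen(2)] by (simp add: ncmul_eq_times)
    qed (auto intro: twosided_gen.zero twosided_gen.add)
  qed
  moreover have "\<exists>z\<in>right_gen A S. x - z \<in> ?I" if y: "y \<in> twosided_gen A S" "x - y \<in> ?I" for x y
  proof -
    obtain z where z: "z \<in> right_gen A S" "y - z \<in> ?I" using two[OF y(1)] by blast
    then show ?thesis using ideal_add[OF y(2) z(2)] by auto
  qed
  ultimately show ?thesis unfolding qmat_cong_def by blast
qed

end
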